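(* Let $\mathcal{A}$ be a Banach algebra and let $E$ be a Banach left $\mathcal{A}$-module. Let $M\subseteq E''$, $L\subseteq\mathcal{A}$ and $N\subseteq E'$ be finite-dimensional subspaces, and let $\epsilon>0$. Let $M_0$ be a finite-dimensional subspace of $E''$ such that $L\cdot M+M\subseteq M_0$. Then there exists a linear map $T:M_0\rightarrow E$ which is a $(1+\epsilon)$-isomorphism onto its range, such that: (1) $\langle\Phi,\mu\rangle=\langle\mu,T(\Phi)\rangle$ for all $\Phi\in M_0$ and $\mu\in N$; (2) $T(\kappa_E(x))=x$ for all $x\in E$ with $\kappa_E(x)\in M_0$; (3) $\|a\cdot T(\Phi)-T(a\cdot\Phi)\|\leq\epsilon\|a\|\|\Phi\|$ for all $a\in L$ and $\Phi\in M$. The analogous result holds for Banach right $\mathcal{A}$-modules (assuming $M\cdot L+M\subseteq M_0$, with (3) replaced by $\|T(\Phi)\cdot a-T(\Phi\cdot a)\|\leq\epsilon\|a\|\|\Phi\|$ for $a\in L$, $\Phi\in M$), and for Banach $\mathcal{A}$-bimodules (assuming $L\cdot M+M\cdot L+M\subseteq M_0$, with (3) replaced by both inequalities, for $a\in L$, $\Phi\in M$).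
   Context: $E'$ is the dual of the Banach space $E$, $\langle\mu,x\rangle=\mu(x)$, and $\kappa_E:E\rightarrow E''$ is the canonical embedding. For a Banach left $\mathcal{A}$-module $E$, $E'$ is a right $\mathcal{A}$-module via $\langle\mu\cdot a,x\rangle=\langle\mu,a\cdot x\rangle$, and $E''$ is a left $\mathcal{A}$-module via $\langle a\cdot\Phi,\mu\rangle=\langle\Phi,\mu\cdot a\rangle$; similarly for right modules and bimodules. $L\cdot M$ (respectively $M\cdot L$) denotes the finite-dimensional subspace of $E''$ spanned by the $a\cdot\Phi$ (respectively $\Phi\cdot a$) with $a\in L,\Phi\in M$. A bounded linear map $T:F\rightarrow G$ between Banach spaces is a $(1+\epsilon)$-isomorphism onto its range if $(1-\epsilon)\|x\|\leq\|T(x)\|\leq(1+\epsilon)\|x\|$ for all $x\in F$. *)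

theory Defs
  imports "HOL-Analysis.Analysis" "HOL-Library.Function_Algebras" "HOL-Library.Set_Algebras"
begin

text \<open>
  The scalar field is a type of sort \<open>{real_normed_field, euclidean_space}\<close>. Both \<^typ>\<open>real\<close> and
  \<^typ>\<open>complex\<close> belong to it and, by the Frobenius theorem, there are no others up to isometric
  isomorphism; so real and complex Banach spaces are treated simultaneously.
\<close>

locale banach_space_over = vector_space scale
  for scale :: "'k::{real_normed_field,euclidean_space} \<Rightarrow> 'e::banach \<Rightarrow> 'e" +
  assumes scale_of_real: "scale (of_real r) x = r *\<^sub>R x"
    and norm_scale: "norm (scale c x) = norm c * norm x"

locale banach_algebra_over = banach_space_over scale
  for scale :: "'k::{real_normed_field,euclidean_space}
      \<Rightarrow> 'a::{banach,real_normed_algebra} \<Rightarrow> 'a" +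
  assumes scale_mult_left: "scale c a * b = scale c (a * b)"
    and scale_mult_right: "a * scale c b = scale c (a * b)"

text \<open>
  Neither the algebra nor its action is assumed to be unital, and the action is only assumed to be
  bounded; contractive actions are the case \<open>C = 1\<close>.
\<close>

locale banach_left_module =
  A: banach_algebra_over scaleA + E: banach_space_over scaleE
  for scaleA :: "'k::{real_normed_field,euclidean_space}
        \<Rightarrow> 'a::{banach,real_normed_algebra} \<Rightarrow> 'a"
    and scaleE :: "'k \<Rightarrow> 'e::banach \<Rightarrow> 'e" +
  fixes lact :: "'a \<Rightarrow> 'e \<Rightarrow> 'e"
  assumes lact_add_left: "lact (a + b) x = lact a x + lact b x"
    and lact_add_right: "lact a (x + y) = lact a x + lact a y"
    and lact_scale_left: "lact (scaleA c a) x = scaleE c (lact a x)"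
    and lact_scale_right: "lact a (scaleE c x) = scaleE c (lact a x)"
    and lact_mult: "lact (a * b) x = lact a (lact b x)"
    and lact_bounded: "\<exists>C. \<forall>a x. norm (lact a x) \<le> C * norm a * norm x"

locale banach_right_module =
  A: banach_algebra_over scaleA + E: banach_space_over scaleE
  for scaleA :: "'k::{real_normed_field,euclidean_space}
        \<Rightarrow> 'a::{banach,real_normed_algebra} \<Rightarrow> 'a"
    and scaleE :: "'k \<Rightarrow> 'e::banach \<Rightarrow> 'e" +
  fixes ract :: "'e \<Rightarrow> 'a \<Rightarrow> 'e"
  assumes ract_add_left: "ract (x + y) a = ract x a + ract y a"
    and ract_add_right: "ract x (a + b) = ract x a + ract x b"
    and ract_scale_left: "ract (scaleE c x) a = scaleE c (ract x a)"
    and ract_scale_right: "ract x (scaleA c a) = scaleE c (ract x a)"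
    and ract_mult: "ract x (a * b) = ract (ract x a) b"
    and ract_bounded: "\<exists>C. \<forall>x a. norm (ract x a) \<le> C * norm x * norm a"

locale banach_bimodule =
  banach_left_module scaleA scaleE lact + banach_right_module scaleA scaleE ract
  for scaleA :: "'k::{real_normed_field,euclidean_space}
        \<Rightarrow> 'a::{banach,real_normed_algebra} \<Rightarrow> 'a"
    and scaleE :: "'k \<Rightarrow> 'e::banach \<Rightarrow> 'e"
    and lact :: "'a \<Rightarrow> 'e \<Rightarrow> 'e" and ract :: "'e \<Rightarrow> 'a \<Rightarrow> 'e" +
  assumes lact_ract: "ract (lact a x) b = lact a (ract x b)"

definition fin_dim_subspace ::
    "('k::field \<Rightarrow> 'v::ab_group_add \<Rightarrow> 'v) \<Rightarrow> 'v set \<Rightarrow> bool" where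
  "fin_dim_subspace s V \<longleftrightarrow> (\<exists>B. finite B \<and> V = module.span s B)"

text \<open>
  For iterating duals, a normed space is given by a carrier \<open>V\<close>, a scalar multiplication \<open>s\<close> and a
  norm \<open>n\<close>. A functional on \<open>V\<close> is represented by a function on the whole type that vanishes
  outside \<open>V\<close>, so that equality of functionals is equality of functions and addition is pointwise.
\<close>

definition restr :: "'v set \<Rightarrow> ('v \<Rightarrow> 'k::zero) \<Rightarrow> 'v \<Rightarrow> 'k" where
  "restr V f = (\<lambda>x. if x \<in> V then f x else 0)"

definition fscale :: "'k::field \<Rightarrow> ('v \<Rightarrow> 'k) \<Rightarrow> 'v \<Rightarrow> 'k" where
  "fscale c f = (\<lambda>x. c * f x)"

definition dual_of :: "'v::ab_group_add set \<Rightarrow> ('k::real_normed_field \<Rightarrow> 'v \<Rightarrow> 'v) \<Rightarrow>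
    ('v \<Rightarrow> real) \<Rightarrow> ('v \<Rightarrow> 'k) set" where
  "dual_of V s n = {f.
     (\<forall>x\<in>V. \<forall>y\<in>V. f (x + y) = f x + f y) \<and>
     (\<forall>c. \<forall>x\<in>V. f (s c x) = c * f x) \<and>
     (\<exists>C. \<forall>x\<in>V. norm (f x) \<le> C * n x) \<and>
     (\<forall>x. x \<notin> V \<longrightarrow> f x = 0)}"

definition dual_norm_of ::
    "'v set \<Rightarrow> ('v \<Rightarrow> real) \<Rightarrow> ('v \<Rightarrow> 'k::real_normed_field) \<Rightarrow> real" where
  "dual_norm_of V n f = (SUP x\<in>{x\<in>V. n x \<le> 1}. norm (f x))"

definition dual :: "('k::real_normed_field \<Rightarrow> 'e::real_normed_vector \<Rightarrow> 'e) \<Rightarrow> ('e \<Rightarrow> 'k) set" where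
  "dual s = dual_of UNIV s norm"

definition dual_norm :: "('e::real_normed_vector \<Rightarrow> 'k::real_normed_field) \<Rightarrow> real" where
  "dual_norm = dual_norm_of UNIV norm"

definition bidual ::
    "('k::real_normed_field \<Rightarrow> 'e::real_normed_vector \<Rightarrow> 'e) \<Rightarrow> (('e \<Rightarrow> 'k) \<Rightarrow> 'k) set" where
  "bidual s = dual_of (dual s) fscale dual_norm"

definition bidual_norm :: "('k::real_normed_field \<Rightarrow> 'e::real_normed_vector \<Rightarrow> 'e) \<Rightarrow>
    (('e \<Rightarrow> 'k) \<Rightarrow> 'k) \<Rightarrow> real" where
  "bidual_norm s = dual_norm_of (dual s) dual_norm"

definition canonical_embedding :: "('k::real_normed_field \<Rightarrow> 'e::real_normed_vector \<Rightarrow> 'e) \<Rightarrow>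
    'e \<Rightarrow> ('e \<Rightarrow> 'k) \<Rightarrow> 'k" where
  "canonical_embedding s x = restr (dual s) (\<lambda>\<mu>. \<mu> x)"

text \<open>The dual of a left action is a right action, and vice versa.\<close>

definition dual_ract :: "'v set \<Rightarrow> ('a \<Rightarrow> 'v \<Rightarrow> 'v) \<Rightarrow> ('v \<Rightarrow> 'k::zero) \<Rightarrow> 'a \<Rightarrow> ('v \<Rightarrow> 'k)" where
  "dual_ract V l f a = restr V (\<lambda>x. f (l a x))"

definition dual_lact :: "'v set \<Rightarrow> ('v \<Rightarrow> 'a \<Rightarrow> 'v) \<Rightarrow> 'a \<Rightarrow> ('v \<Rightarrow> 'k::zero) \<Rightarrow> ('v \<Rightarrow> 'k)" where
  "dual_lact V r a f = restr V (\<lambda>x. f (r x a))"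

definition bidual_lact :: "('k::real_normed_field \<Rightarrow> 'e::real_normed_vector \<Rightarrow> 'e) \<Rightarrow>
    ('a \<Rightarrow> 'e \<Rightarrow> 'e) \<Rightarrow> 'a \<Rightarrow> (('e \<Rightarrow> 'k) \<Rightarrow> 'k) \<Rightarrow> (('e \<Rightarrow> 'k) \<Rightarrow> 'k)" where
  "bidual_lact s l = dual_lact (dual s) (dual_ract UNIV l)"

definition bidual_ract :: "('k::real_normed_field \<Rightarrow> 'e::real_normed_vector \<Rightarrow> 'e) \<Rightarrow>
    ('e \<Rightarrow> 'a \<Rightarrow> 'e) \<Rightarrow> (('e \<Rightarrow> 'k) \<Rightarrow> 'k) \<Rightarrow> 'a \<Rightarrow> (('e \<Rightarrow> 'k) \<Rightarrow> 'k)" where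
  "bidual_ract s r = dual_ract (dual s) (dual_lact UNIV r)"

definition left_product_span :: "('a \<Rightarrow> ('v \<Rightarrow> 'k) \<Rightarrow> ('v \<Rightarrow> 'k)) \<Rightarrow>
    'a set \<Rightarrow> ('v \<Rightarrow> 'k::field) set \<Rightarrow> ('v \<Rightarrow> 'k) set" where
  "left_product_span l L M = module.span fscale {l a \<Phi> |a \<Phi>. a \<in> L \<and> \<Phi> \<in> M}"

definition right_product_span :: "(('v \<Rightarrow> 'k) \<Rightarrow> 'a \<Rightarrow> ('v \<Rightarrow> 'k)) \<Rightarrow>
    ('v \<Rightarrow> 'k::field) set \<Rightarrow> 'a set \<Rightarrow> ('v \<Rightarrow> 'k) set" where
  "right_product_span r M L = module.span fscale {r \<Phi> a |\<Phi> a. \<Phi> \<in> M \<and> a \<in> L}"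

definition linear_map_on :: "'v::ab_group_add set \<Rightarrow> ('k \<Rightarrow> 'v \<Rightarrow> 'v) \<Rightarrow>
    ('k \<Rightarrow> 'w::ab_group_add \<Rightarrow> 'w) \<Rightarrow> ('v \<Rightarrow> 'w) \<Rightarrow> bool" where
  "linear_map_on V s t T \<longleftrightarrow>
     (\<forall>x\<in>V. \<forall>y\<in>V. T (x + y) = T x + T y) \<and> (\<forall>c. \<forall>x\<in>V. T (s c x) = t c (T x))"

text \<open>
  A \<open>(1 + \<epsilon>)\<close>-isomorphism from the subspace \<open>V\<close> with norm \<open>n\<close> onto its range; boundedness of \<open>T\<close>
  is part of the upper estimate.
\<close>

definition eps_isomorphism_on :: "real \<Rightarrow> 'v::ab_group_add set \<Rightarrow> ('k \<Rightarrow> 'v \<Rightarrow> 'v) \<Rightarrow>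
    ('v \<Rightarrow> real) \<Rightarrow> ('k \<Rightarrow> 'w::real_normed_vector \<Rightarrow> 'w) \<Rightarrow> ('v \<Rightarrow> 'w) \<Rightarrow> bool" where
  "eps_isomorphism_on \<epsilon> V s n t T \<longleftrightarrow> linear_map_on V s t T \<and>
     (\<forall>x\<in>V. (1 - \<epsilon>) * n x \<le> norm (T x) \<and> norm (T x) \<le> (1 + \<epsilon>) * n x)"

lemma banach_space_over_real: "banach_space_over ((*\<^sub>R) :: real \<Rightarrow> 'e::banach \<Rightarrow> 'e)"
  by unfold_locales (simp_all add: scaleR_add_right scaleR_add_left)

lemma banach_space_over_complex: "banach_space_over ((*) :: complex \<Rightarrow> complex \<Rightarrow> complex)"
  by unfold_locales (simp_all add: algebra_simps norm_mult scaleR_conv_of_real)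

lemma vector_space_fscale: "vector_space fscale"
  by unfold_locales (auto simp: fscale_def algebra_simps fun_eq_iff)

end

theory Submission
  imports Defs
begin

text \<open>
  A basis of \<open>M\<^sub>0\<close> extending one of \<open>M\<^sub>0 \<inter> \<kappa>(E)\<close> turns \<open>T\<close> into finitely many unknown vectors of
  \<open>E\<close>: the values of \<open>T\<close> at the remaining basis elements. What is required of \<open>T\<close> becomes exact
  equations against \<open>N\<close> and finitely many inequalities for norms of affine functions of the
  unknowns, one for each point of a finite net in \<open>M\<^sub>0\<close> and each pair of basis elements of \<open>L\<close> and
  \<open>M\<close>; the lower norm estimate comes from enlarging \<open>N\<close>. The basis elements themselves solve the system in
  \<open>E''\<close>, with module defect zero. If no solution in \<open>E\<close> were close, a functional on a finite power
  of \<open>E\<close> would separate the affine set of exact solutions from a slightly larger box; evaluating the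
  elements of \<open>E''\<close> at this functional gives a contradiction.

  Over the abstract scalar field, real functionals are turned into scalar ones through the
  conjugation \<open>w \<mapsto> \<bar>w\<bar>\<^sup>2 / w\<close>, which is additive because the norm is both multiplicative and Euclidean.
\<close>

section \<open>Conjugation on the scalar field\<close>

text \<open>Two dependencies dictate the order of the choices. The net must be fine relative to a
  bound for \<open>T\<close> that is known before \<open>T\<close> exists. A fixed spanning family
  of \<open>M\<^sub>0\<close>, placed among the points whose norms are controlled, supplies such a
  bound, whatever the net. Likewise the tolerance for the module defect is fixed before
  \<open>T\<close>, which is possible because the defect is bilinear in the algebra element and the
  functional.

  The equations against \<open>N\<close> stay exact because they define the affine set that is
  separated. A functional bounded below along a line is constant on it, so its pullback to each
  unknown vanishes on the common kernel of \<open>N\<close> and, \<open>N\<close> being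
  finite-dimensional, lies in \<open>N\<close>. Only there do elements of the bidual and their
  substitutes in \<open>E\<close> agree, and this is what makes the evaluation possible. The
  separation itself is the purely algebraic Mazur-Orlicz theorem for a maximum norm, whose dual is a
  sum of dual norms. The norm conditions lose a factor \<open>1 + \<delta>\<close>, and this slack
  produces the contradiction.\<close>

definition field_cnj :: "'k::{real_normed_field,euclidean_space} \<Rightarrow> 'k" where
  "field_cnj w = of_real ((norm w)\<^sup>2) * inverse w"

text \<open>Multiplication by \<open>z\<close> scales every norm by the same factor, and
  polarization carries this over to the inner product.\<close>

lemma inner_mult_mult_right:
  fixes x y z :: "'k::{real_normed_field,euclidean_space}"
  shows "inner (x * z) (y * z) = (norm z)\<^sup>2 * inner x y"
proof -
  have [simp]: "x * z + y * z = (x + y) * z" by (simp add: algebra_simps)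
  have "inner (x * z) (y * z) = ((norm ((x + y) * z))\<^sup>2 - (norm (x * z))\<^sup>2 - (norm (y * z))\<^sup>2) / 2"
    by (subst dot_norm) simp
  also have "\<dots> = (norm z)\<^sup>2 * (((norm (x + y))\<^sup>2 - (norm x)\<^sup>2 - (norm y)\<^sup>2) / 2)"
    by (simp add: norm_mult power_mult_distrib right_diff_distrib)
  finally show ?thesis by (simp only: dot_norm)
qed

lemma field_cnj_0 [simp]: "field_cnj 0 = 0"
  by (simp add: field_cnj_def)

lemma field_cnj_mult: "field_cnj (u * v) = field_cnj u * field_cnj v"
  by (simp add: field_cnj_def norm_mult power_mult_distrib)

lemma norm_field_cnj [simp]: "norm (field_cnj w) = norm w"
  by (cases "w = 0") (simp_all add: field_cnj_def norm_mult norm_inverse power2_eq_square)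

lemma field_cnj_cnj [simp]: "field_cnj (field_cnj w) = w"
proof (cases "w = 0")
  case False
  then have "field_cnj (field_cnj w) = of_real ((norm w)\<^sup>2) * inverse (of_real ((norm w)\<^sup>2) * inverse w)"
    by (metis field_cnj_def norm_field_cnj)
  also have "\<dots> = w" using False by simp
  finally show ?thesis .
qed simp

text \<open>Writing \<open>z\<close> as \<open>(z / w) * w\<close> and \<open>w\<close> as
  \<open>1 * w\<close> exposes a common factor \<open>w\<close>, which leaves the inner product as
  its squared norm. Over the complex numbers this is the formula Re(z cnj w).\<close>

lemma inner_eq_cnj:
  fixes z w :: "'k::{real_normed_field,euclidean_space}"
  shows "inner z w = inner (z * field_cnj w) 1"
proof (cases "w = 0")
  case False
  have "inner z w = inner (z * inverse w * w) (1 * w)" using False by (simp add: mult.assoc)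
  also have "\<dots> = (norm w)\<^sup>2 * inner (z * inverse w) 1" by (rule inner_mult_mult_right)
  also have "\<dots> = inner ((norm w)\<^sup>2 *\<^sub>R (z * inverse w)) 1" by (simp only: inner_scaleR_left)
  also have "(norm w)\<^sup>2 *\<^sub>R (z * inverse w) = z * field_cnj w"
    by (simp only: field_cnj_def scaleR_conv_of_real mult.assoc mult.commute mult.left_commute)
  finally show ?thesis .
qed simp

lemma eq_zero_if_inner_mult_zero:
  fixes d :: "'k::{real_normed_field,euclidean_space}"
  assumes "\<And>z. inner (z * d) 1 = 0"
  shows "d = 0"
proof (rule ccontr)
  assume "d \<noteq> 0"
  then have "inner (inverse d * d) 1 = 1" by (simp add: norm_eq_1[symmetric])
  with assms[of "inverse d"] show False by simp
qed

text \<open>The inner product is additive in its second argument; \<open>inner_eq_cnj\<close> moves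
  this to the conjugation, and testing against all multiples shows that the difference
  vanishes.\<close>

lemma field_cnj_add:
  fixes v w :: "'k::{real_normed_field,euclidean_space}"
  shows "field_cnj (v + w) = field_cnj v + field_cnj w"
proof -
  have "field_cnj (v + w) - field_cnj v - field_cnj w = 0"
    by (rule eq_zero_if_inner_mult_zero)
       (simp add: right_diff_distrib inner_diff_left inner_eq_cnj[symmetric] inner_add_right)
  then show ?thesis by (simp add: algebra_simps)
qed

lemma field_cnj_scaleR:
  fixes w :: "'k::{real_normed_field,euclidean_space}"
  shows "field_cnj (r *\<^sub>R w) = r *\<^sub>R field_cnj w"
proof -
  have "field_cnj (of_real r :: 'k) = of_real r"
    by (cases "r = 0") (simp_all add: field_cnj_def power2_eq_square flip: of_real_mult of_real_inverse)
  then show ?thesis by (simp add: scaleR_conv_of_real field_cnj_mult)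
qed

lemma field_cnj_mult_self: "z * field_cnj z = of_real ((norm z)\<^sup>2)"
  by (cases "z = 0") (simp_all add: field_cnj_def)

section \<open>Sublinear functionals\<close>

text \<open>Only one inequality for positive factors is demanded, since applying it to
  \<open>t\<close> and to its inverse gives equality. The scaling is a parameter because such
  functionals are used both on the space itself and on families of vectors.\<close>

definition sublinear_wrt :: "(real \<Rightarrow> 'v \<Rightarrow> 'v) \<Rightarrow> ('v::ab_group_add \<Rightarrow> real) \<Rightarrow> bool" where
  "sublinear_wrt sc p \<longleftrightarrow> (\<forall>x y. p (x + y) \<le> p x + p y) \<and> (\<forall>t>0. \<forall>x. p (sc t x) \<le> t * p x)"

locale sublinear_functional = vector_space sc
  for sc :: "real \<Rightarrow> 'v::ab_group_add \<Rightarrow> 'v" +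
  fixes p :: "'v \<Rightarrow> real"
  assumes sublinear: "sublinear_wrt sc p"
begin

lemma subadd: "p (x + y) \<le> p x + p y"
  using sublinear by (simp add: sublinear_wrt_def)

lemma zero: "p 0 = 0"
proof -
  have "p 0 \<le> (1/2) * p 0" "p 0 \<le> 2 * p 0"
    using sublinear scale_zero_right unfolding sublinear_wrt_def by (metis half_gt_zero_iff zero_less_one, metis zero_less_numeral)
  then show ?thesis by simp
qed

lemma homogeneous: assumes "t \<ge> 0" shows "p (sc t x) = t * p x"
proof (cases "t = 0")
  case False
  then have t: "t > 0" using assms by simp
  have "p (sc (inverse t) (sc t x)) \<le> inverse t * p (sc t x)"
    using t sublinear unfolding sublinear_wrt_def by (meson positive_imp_inverse_positive)
  then have "p x \<le> inverse t * p (sc t x)" using t by simp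
  then have "t * p x \<le> p (sc t x)" using t by (simp add: field_simps)
  moreover have "p (sc t x) \<le> t * p x" using t sublinear unfolding sublinear_wrt_def by blast
  ultimately show ?thesis by simp
qed (simp add: zero)

lemma lower_bound: "- p (- x) \<le> p x"
  using subadd[of x "- x"] zero by simp

text \<open>\<open>P\<close> is the infimum of \<open>p (u + s c) - s \<alpha>\<close> over the cone
  of pairs \<open>(s, c)\<close>, the largest sublinear functional below \<open>p\<close> with the
  last property. Its use: a linear \<open>f\<close> below \<open>P\<close> satisfies
  \<open>- f c = f (- c) \<le> - \<alpha>\<close>, so it is at least \<open>\<alpha>\<close> on
  \<open>C\<close>.\<close>

lemma shift:
  assumes ne: "C \<noteq> {}" and al: "\<And>c. c \<in> C \<Longrightarrow> \<alpha> \<le> p c"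
    and cv: "\<And>c d s. c \<in> C \<Longrightarrow> d \<in> C \<Longrightarrow> 0 \<le> s \<Longrightarrow> s \<le> 1 \<Longrightarrow> sc s c + sc (1 - s) d \<in> C"
  obtains P where "sublinear_wrt sc P" "\<And>x. P x \<le> p x" "\<And>c. c \<in> C \<Longrightarrow> P (- c) \<le> - \<alpha>"
proof -
  define J where "J = {0::real..} \<times> C"
  define g where "g = (\<lambda>u (s, c). p (u + sc s c) - s * \<alpha>)"
  define P where "P u = Inf (g u ` J)" for u
  have Jne: "g u ` J \<noteq> {}" for u using ne by (auto simp: J_def)
  \<comment> \<open>The infimum is finite precisely because \<open>p\<close> is at least
    \<open>\<alpha>\<close> on \<open>C\<close>.\<close>
  have low: "- p (- u) \<le> g u j" if jJ: "j \<in> J" for u j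
  proof -
    obtain s c where j: "j = (s, c)" "s \<ge> 0" "c \<in> C" using jJ by (auto simp: J_def)
    have "s * \<alpha> \<le> p (sc s c)" using homogeneous[OF j(2)] al[OF j(3)] j(2) by (simp add: mult_left_mono)
    also have "\<dots> \<le> p (- u) + p (u + sc s c)" using subadd[of "- u" "u + sc s c"] by simp
    finally show ?thesis by (simp add: g_def j)
  qed
  have bdd: "bdd_below (g u ` J)" for u using low by (meson bdd_belowI2)
  have up: "P u \<le> g u j" if "j \<in> J" for u j
    unfolding P_def using bdd that by (simp add: cINF_lower)
  have gr: "a \<le> P u" if "\<And>j. j \<in> J \<Longrightarrow> a \<le> g u j" for a u
    unfolding P_def using Jne that by (intro cInf_greatest) auto
  show ?thesis
  proof
    show "P x \<le> p x" for x
    proof -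
      obtain c where "c \<in> C" using ne by blast
      then have "(0, c) \<in> J" by (simp add: J_def)
      from up[OF this, of x] show ?thesis by (simp add: g_def)
    qed
    show "P (- c) \<le> - \<alpha>" if "c \<in> C" for c
    proof -
      have "(1, c) \<in> J" using that by (simp add: J_def)
      from up[OF this, of "- c"] show ?thesis by (simp add: g_def zero)
    qed
    have add: "P (x + y) \<le> g x j + g y k" if jk: "j \<in> J" "k \<in> J" for x y j k
    proof -
      obtain s c where j: "j = (s, c)" "s \<ge> 0" "c \<in> C" using jk by (auto simp: J_def)
      obtain t d where k: "k = (t, d)" "t \<ge> 0" "d \<in> C" using jk by (auto simp: J_def)
      \<comment> \<open>Convexity merges two points of the cone over \<open>C\<close> into one. If
        both weights vanish, any element of \<open>C\<close> serves.\<close>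
      obtain e where e: "e \<in> C" "sc (s + t) e = sc s c + sc t d"
      proof (cases "s + t = 0")
        case True then show ?thesis using that[of c] j k by (simp add: add_nonneg_eq_0_iff)
      next
        case False
        then have st: "s + t > 0" using j k by simp
        have "1 - s / (s + t) = t / (s + t)" using st by (simp add: field_simps)
        then have "sc (s / (s + t)) c + sc (t / (s + t)) d \<in> C"
          using cv[of c d "s / (s + t)"] j k st by simp
        moreover have "sc (s + t) (sc (s / (s + t)) c + sc (t / (s + t)) d) = sc s c + sc t d"
          using st by (simp add: scale_right_distrib)
        ultimately show ?thesis using that by blast
      qed
      have "(s + t, e) \<in> J" using e j k by (simp add: J_def)
      then have "P (x + y) \<le> p ((x + y) + sc (s + t) e) - (s + t) * \<alpha>"
        using up by (fastforce simp: g_def)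
      also have "(x + y) + sc (s + t) e = (x + sc s c) + (y + sc t d)"
        by (simp only: e(2) ac_simps)
      also have "p \<dots> \<le> p (x + sc s c) + p (y + sc t d)" by (rule subadd)
      finally show ?thesis by (simp add: g_def j k algebra_simps)
    qed
    have hom: "P (sc t x) \<le> t * g x j" if t: "t > 0" and jJ: "j \<in> J" for t x j
    proof -
      obtain s c where j: "j = (s, c)" "s \<ge> 0" "c \<in> C" using jJ by (auto simp: J_def)
      have "(t * s, c) \<in> J" using t j by (simp add: J_def)
      then have "P (sc t x) \<le> p (sc t x + sc (t * s) c) - t * s * \<alpha>"
        using up by (fastforce simp: g_def)
      also have "sc t x + sc (t * s) c = sc t (x + sc s c)" by (simp add: scale_right_distrib)
      also have "p (sc t (x + sc s c)) = t * p (x + sc s c)" using t by (simp add: homogeneous)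
      finally show ?thesis by (simp add: g_def j algebra_simps)
    qed
    show "sublinear_wrt sc P"
      unfolding sublinear_wrt_def
    proof (intro conjI allI impI)
      fix x y
      have "P (x + y) - P x \<le> P y"
      proof (rule gr)
        fix k assume k: "k \<in> J"
        have "P (x + y) - g y k \<le> P x" using add[OF _ k] by (intro gr) (smt (verit))
        then show "P (x + y) - P x \<le> g y k" by simp
      qed
      then show "P (x + y) \<le> P x + P y" by simp
    next
      fix t :: real and x assume t: "t > 0"
      have "P (sc t x) / t \<le> P x" using hom[OF t] t by (intro gr) (simp add: field_simps)
      then show "P (sc t x) \<le> t * P x" using t by (simp add: field_simps)
    qed
  qed
qed

text \<open>Zorn's lemma for the reversed pointwise order. The pointwise infimum of a chain bounds
  it from below, and it is finite because \<open>q x \<ge> - q (- x) \<ge> - p (- x)\<close> for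
  every member \<open>q\<close>.\<close>

lemma ex_minimal:
  obtains q where "sublinear_wrt sc q" "\<And>x. q x \<le> p x"
    "\<And>q'. sublinear_wrt sc q' \<Longrightarrow> q' \<le> q \<Longrightarrow> q' = q"
proof -
  define A where "A = {q. sublinear_wrt sc q \<and> q \<le> p}"
  have "\<exists>m\<in>A. \<forall>a\<in>A. m \<ge> a \<longrightarrow> a = m"
  proof (rule predicate_Zorn)
    show "partial_order_on A (relation_of (\<ge>) A)"
      by (rule partial_order_on_relation_ofI) auto
    fix C assume "C \<in> Chains (relation_of (\<ge>) A)"
    then have CA: "C \<subseteq> A" and ch: "\<And>q r. q \<in> C \<Longrightarrow> r \<in> C \<Longrightarrow> q \<le> r \<or> r \<le> q"
      by (auto simp: Chains_def relation_of_def)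
    show "\<exists>u\<in>A. \<forall>a\<in>C. a \<ge> u"
    proof (cases "C = {}")
      case True
      then show ?thesis using sublinear by (auto simp: A_def)
    next
      case False
      define u where "u x = (INF q\<in>C. q x)" for x
      have sub: "sublinear_functional sc q" if "q \<in> C" for q
        using that CA by unfold_locales (auto simp: A_def)
      have low: "- p (- x) \<le> q x" if "q \<in> C" for q x
      proof -
        have "q (- x) \<le> p (- x)" using that CA by (auto simp: A_def le_fun_def)
        then show ?thesis using sublinear_functional.lower_bound[OF sub[OF that], of x] by simp
      qed
      have up: "u x \<le> q x" if "q \<in> C" for q x
        unfolding u_def using low that by (intro cINF_lower bdd_belowI2) auto
      have gr: "a \<le> u x" if "\<And>q. q \<in> C \<Longrightarrow> a \<le> q x" for a x
        unfolding u_def using False that by (intro cINF_greatest)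
      have add: "u (x + y) \<le> q x + r y" if qr: "q \<in> C" "r \<in> C" for q r x y
      proof -
        \<comment> \<open>In a chain, one of the two members lies below both, so the subadditivity
          of a single functional suffices.\<close>
        obtain z where z: "z \<in> C" "z \<le> q" "z \<le> r" using ch[OF qr] qr by blast
        have "u (x + y) \<le> z x + z y"
          using up[OF z(1)] sublinear_functional.subadd[OF sub[OF z(1)]] order_trans by blast
        also have "\<dots> \<le> q x + r y" using z by (intro add_mono) (auto simp: le_fun_def)
        finally show ?thesis .
      qed
      have "sublinear_wrt sc u"
        unfolding sublinear_wrt_def
      proof (intro conjI allI impI)
        fix x y
        have "u (x + y) - u x \<le> u y"
        proof (rule gr)
          fix r assume r: "r \<in> C"
          have "u (x + y) - r y \<le> u x" using add[OF _ r] by (intro gr) (smt (verit))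
          then show "u (x + y) - u x \<le> r y" by simp
        qed
        then show "u (x + y) \<le> u x + u y" by simp
      next
        fix t :: real and x assume t: "t > 0"
        have "u (sc t x) / t \<le> u x"
        proof (rule gr)
          fix q assume q: "q \<in> C"
          have "u (sc t x) \<le> t * q x"
            using up[OF q] sublinear_functional.homogeneous[OF sub[OF q]] t by (metis less_imp_le)
          then show "u (sc t x) / t \<le> q x" using t by (simp add: field_simps)
        qed
        then show "u (sc t x) \<le> t * u x" using t by (simp add: field_simps)
      qed
      moreover have "u \<le> p"
      proof (rule le_funI)
        fix x obtain q where "q \<in> C" using False by blast
        then have "u x \<le> q x" "q x \<le> p x" using up CA by (auto simp: A_def le_fun_def)
        then show "u x \<le> p x" by (rule order_trans)
      qed
      ultimately show ?thesis using up by (auto simp: A_def le_fun_def)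
    qed
  qed
  then obtain q where "q \<in> A" "\<forall>a\<in>A. q \<ge> a \<longrightarrow> a = q" by blast
  moreover have "r \<in> A" if "sublinear_wrt sc r" "r \<le> q" for r
    using that \<open>q \<in> A\<close> by (auto simp: A_def)
  ultimately show ?thesis using that[of q] by (auto simp: A_def le_fun_def)
qed

text \<open>A minimal sublinear functional is linear: shifting it along \<open>y\<close> does not change it.\<close>

lemma ex_linear_below:
  obtains f where "\<And>x y. f (x + y) = f x + f y" "\<And>t x. f (sc t x) = t * f x" "\<And>x. f x \<le> p x"
proof -
  obtain q where q: "sublinear_wrt sc q" "\<And>x. q x \<le> p x"
    and min: "\<And>q'. sublinear_wrt sc q' \<Longrightarrow> q' \<le> q \<Longrightarrow> q' = q"
    using ex_minimal by blast
  interpret q: sublinear_functional sc q by unfold_locales (rule q)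
  have neg: "q (- y) = - q y" for y
  proof -
    obtain P where P: "sublinear_wrt sc P" "\<And>x. P x \<le> q x" "P (- y) \<le> - q y"
      by (rule q.shift[of "{y}" "q y"]) (auto simp: scale_left_distrib[symmetric])
    have "P = q" using min P by (simp add: le_fun_def)
    then show ?thesis using P(3) q.lower_bound[of "- y"] by simp
  qed
  have add: "q (x + y) = q x + q y" for x y
    using q.subadd[of x y] q.subadd[of "x + y" "- y"] neg[of y] by simp
  have "q (sc t x) = t * q x" for t x
  proof (cases "t \<ge> 0")
    case False
    then have "q (sc (- t) x) = - t * q x" by (intro q.homogeneous) simp
    then show ?thesis using neg[of "sc t x"] by simp
  qed (rule q.homogeneous)
  with add q(2) show ?thesis using that by blast
qed

text \<open>The Hahn-Banach theorem in algebraic form: a linear functional below the shifted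
  \<open>P\<close> has both properties at once.\<close>

lemma mazur_orlicz:
  assumes "C \<noteq> {}" "\<And>c. c \<in> C \<Longrightarrow> \<alpha> \<le> p c"
    and "\<And>c d s. c \<in> C \<Longrightarrow> d \<in> C \<Longrightarrow> 0 \<le> s \<Longrightarrow> s \<le> 1 \<Longrightarrow> sc s c + sc (1 - s) d \<in> C"
  obtains f where "\<And>x y. f (x + y) = f x + f y" "\<And>t x. f (sc t x) = t * f x" "\<And>x. f x \<le> p x"
    "\<And>c. c \<in> C \<Longrightarrow> \<alpha> \<le> f c"
proof -
  obtain P where P: "sublinear_wrt sc P" "\<And>x. P x \<le> p x" "\<And>c. c \<in> C \<Longrightarrow> P (- c) \<le> - \<alpha>"
    using shift assms by blast
  interpret P: sublinear_functional sc P by unfold_locales (rule P)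
  obtain f where f: "\<And>x y. f (x + y) = f x + f y" "\<And>t x. f (sc t x) = t * f x" "\<And>x. f x \<le> P x"
    using P.ex_linear_below by blast
  have "\<alpha> \<le> f c" if "c \<in> C" for c
    using f(2)[of "-1" c] f(3)[of "- c"] P(3)[OF that] by simp
  then show ?thesis using that[of f] f P(2) order_trans by blast
qed

end

section \<open>Dual norms\<close>

interpretation fs: vector_space "fscale :: 'k::field \<Rightarrow> ('v \<Rightarrow> 'k) \<Rightarrow> 'v \<Rightarrow> 'k"
  by (rule vector_space_fscale)

lemma fscale_apply: "fscale c f x = c * f x"
  by (simp add: fscale_def)

lemma sum_fun_apply: "(\<Sum>i\<in>I. f i) x = (\<Sum>i\<in>I. f i x)"
  for f :: "'i \<Rightarrow> 'v \<Rightarrow> 'k::comm_monoid_add"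
  by (induction I rule: infinite_finite_induct) auto

lemma subspace_dual_of: "fs.subspace (dual_of V s n)"
proof (rule fs.subspaceI)
  show "0 \<in> dual_of V s n" by (auto simp: dual_of_def intro: exI[of _ 0])
next
  fix f g assume f: "f \<in> dual_of V s n" and g: "g \<in> dual_of V s n"
  from f obtain C where C: "\<forall>x\<in>V. norm (f x) \<le> C * n x" by (auto simp: dual_of_def)
  from g obtain D where D: "\<forall>x\<in>V. norm (g x) \<le> D * n x" by (auto simp: dual_of_def)
  have "\<forall>x\<in>V. norm (f x + g x) \<le> (C + D) * n x"
    using C D by (auto simp: distrib_right intro: norm_triangle_mono)
  then have "\<exists>K. \<forall>x\<in>V. norm (f x + g x) \<le> K * n x" ..
  then show "f + g \<in> dual_of V s n" using f g by (simp add: dual_of_def ac_simps distrib_left)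
next
  fix c f assume f: "f \<in> dual_of V s n"
  then obtain C where C: "\<forall>x\<in>V. norm (f x) \<le> C * n x" by (auto simp: dual_of_def)
  have "\<forall>x\<in>V. norm (c * f x) \<le> (norm c * C) * n x"
    using C by (auto simp: fscale_apply norm_mult mult.assoc intro: mult_left_mono)
  then have "\<exists>K. \<forall>x\<in>V. norm (c * f x) \<le> K * n x" ..
  then show "fscale c f \<in> dual_of V s n" using f by (simp add: dual_of_def fscale_apply ac_simps distrib_left)
qed

text \<open>A common interface for the space, its dual and its bidual. Since the dual norm is again
  an instance, estimates proved here can be iterated.\<close>

locale seminormed_on =
  fixes V :: "'v::ab_group_add set" and s :: "'k::real_normed_field \<Rightarrow> 'v \<Rightarrow> 'v" and n :: "'v \<Rightarrow> real"
  assumes zero_mem: "0 \<in> V" and n_zero: "n 0 = 0"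
    and scale_mem: "x \<in> V \<Longrightarrow> s c x \<in> V"
    and n_scale: "x \<in> V \<Longrightarrow> n (s c x) = norm c * n x"
    and n_nonneg: "x \<in> V \<Longrightarrow> 0 \<le> n x"
begin

lemma bdd: assumes "f \<in> dual_of V s n" shows "bdd_above ((\<lambda>x. norm (f x)) ` {x \<in> V. n x \<le> 1})"
proof -
  from assms obtain C where C: "\<forall>x\<in>V. norm (f x) \<le> C * n x" by (auto simp: dual_of_def)
  \<comment> \<open>The constant may be negative, so it is replaced by its absolute value before
    \<open>n x\<close> is estimated by 1.\<close>
  have "norm (f x) \<le> \<bar>C\<bar>" if "x \<in> V" "n x \<le> 1" for x
  proof -
    have "C * n x \<le> \<bar>C\<bar> * 1" using that n_nonneg by (intro mult_mono) auto
    with C that show ?thesis by force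
  qed
  then show ?thesis by (intro bdd_aboveI2) auto
qed

lemma norm_le_dual_norm_of:
  assumes f: "f \<in> dual_of V s n" and x: "x \<in> V"
  shows "norm (f x) \<le> dual_norm_of V n f * n x"
proof (cases "n x = 0")
  case True
  \<comment> \<open>Here \<open>x\<close> cannot be normalised, but any bounding constant forces
    \<open>f x = 0\<close>.\<close>
  from f obtain C where "\<forall>x\<in>V. norm (f x) \<le> C * n x" by (auto simp: dual_of_def)
  with True x show ?thesis by force
next
  case False
  then have pos: "n x > 0" using n_nonneg[OF x] by simp
  define y where "y = s (of_real (inverse (n x))) x"
  have y: "y \<in> V" "n y = 1" using pos x scale_mem n_scale by (auto simp: y_def norm_inverse)
  have "norm (f y) \<le> dual_norm_of V n f"
    unfolding dual_norm_of_def using y by (intro cSUP_upper bdd f) auto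
  moreover have "f y = of_real (inverse (n x)) * f x" using f x by (auto simp: y_def dual_of_def)
  ultimately have "inverse (n x) * norm (f x) \<le> dual_norm_of V n f"
    using pos by (simp add: norm_mult norm_inverse)
  then show ?thesis using pos by (simp add: field_simps)
qed

lemma dual_norm_of_le:
  assumes "C \<ge> 0" "\<And>x. x \<in> V \<Longrightarrow> norm (f x) \<le> C * n x"
  shows "dual_norm_of V n f \<le> C"
  unfolding dual_norm_of_def
proof (rule cSUP_least)
  show "{x \<in> V. n x \<le> 1} \<noteq> {}" using zero_mem n_zero by force
  fix x assume "x \<in> {x \<in> V. n x \<le> 1}"
  then have "norm (f x) \<le> C * n x" "C * n x \<le> C * 1" using assms by (auto simp del: mult_1_right intro!: mult_left_mono)
  then show "norm (f x) \<le> C" by simp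
qed

lemma dual_norm_of_nonneg: assumes "f \<in> dual_of V s n" shows "0 \<le> dual_norm_of V n f"
proof -
  have "norm (f 0) \<le> dual_norm_of V n f"
    unfolding dual_norm_of_def using zero_mem n_zero by (intro cSUP_upper bdd assms) auto
  then show ?thesis using norm_ge_zero order_trans by blast
qed

lemma dual_norm_of_approx:
  assumes "f \<in> dual_of V s n" "\<eta> > 0"
  obtains x where "x \<in> V" "n x \<le> 1" "dual_norm_of V n f - \<eta> < norm (f x)"
proof -
  have "{x \<in> V. n x \<le> 1} \<noteq> {}" using zero_mem n_zero by force
  moreover have "dual_norm_of V n f - \<eta> < (SUP x\<in>{x \<in> V. n x \<le> 1}. norm (f x))"
    using assms(2) by (simp add: dual_norm_of_def)
  ultimately show ?thesis using less_cSUP_iff[OF _ bdd[OF assms(1)]] that by blast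
qed

lemma dual_norm_of_add:
  assumes "f \<in> dual_of V s n" "g \<in> dual_of V s n"
  shows "dual_norm_of V n (f + g) \<le> dual_norm_of V n f + dual_norm_of V n g"
  using assms norm_le_dual_norm_of dual_norm_of_nonneg
  by (intro dual_norm_of_le) (auto simp: distrib_right intro!: norm_triangle_mono)

lemma dual_norm_of_zero: "dual_norm_of V n (0 :: 'v \<Rightarrow> 'k) = 0"
proof (rule order_antisym)
  show "dual_norm_of V n (0 :: 'v \<Rightarrow> 'k) \<le> 0" by (rule dual_norm_of_le) simp_all
  show "0 \<le> dual_norm_of V n (0 :: 'v \<Rightarrow> 'k)" by (rule dual_norm_of_nonneg[OF fs.subspace_0[OF subspace_dual_of]])
qed

lemma dual_norm_of_fscale:
  assumes f: "f \<in> dual_of V s n"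
  shows "dual_norm_of V n (fscale c f) = norm c * dual_norm_of V n f"
proof (cases "c = 0")
  case False
  have le: "dual_norm_of V n (fscale d g) \<le> norm d * dual_norm_of V n g" if "g \<in> dual_of V s n" for d g
    using that norm_le_dual_norm_of dual_norm_of_nonneg
    by (intro dual_norm_of_le) (auto simp: fscale_apply norm_mult mult.assoc intro: mult_left_mono)
  have "fscale c f \<in> dual_of V s n" using f by (rule fs.subspace_scale[OF subspace_dual_of])
  from le[OF this, of "inverse c"] False
  have "dual_norm_of V n f \<le> inverse (norm c) * dual_norm_of V n (fscale c f)"
    by (simp add: norm_inverse)
  then have "norm c * dual_norm_of V n f \<le> dual_norm_of V n (fscale c f)"
    using False by (simp add: field_simps)
  then show ?thesis using le[OF f, of c] by simp
next
  case True
  then show ?thesis using dual_norm_of_zero by simp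
qed

lemma seminormed_on_dual: "seminormed_on (dual_of V s n) fscale (dual_norm_of V n)"
  by unfold_locales
    (auto simp: fs.subspace_0[OF subspace_dual_of] fs.subspace_scale[OF subspace_dual_of]
      dual_norm_of_zero dual_norm_of_fscale dual_norm_of_nonneg)

lemma dual_norm_of_sum:
  assumes "\<And>i. i \<in> I \<Longrightarrow> f i \<in> dual_of V s n"
  shows "dual_norm_of V n (\<Sum>i\<in>I. f i) \<le> (\<Sum>i\<in>I. dual_norm_of V n (f i))"
  using assms
proof (induction I rule: infinite_finite_induct)
  case (insert i I)
  then have "dual_norm_of V n (f i + sum f I) \<le> dual_norm_of V n (f i) + dual_norm_of V n (sum f I)"
    by (intro dual_norm_of_add fs.subspace_sum[OF subspace_dual_of]) auto
  moreover have "dual_norm_of V n (sum f I) \<le> (\<Sum>i\<in>I. dual_norm_of V n (f i))" using insert by blast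
  ultimately show ?case using insert(1,2) by (simp del: plus_fun_apply)
qed (simp_all add: dual_norm_of_zero)

end

section \<open>Finite-dimensional spaces of functions\<close>

text \<open>The induction maintains that \<open>e\<close> is biorthogonal to the evaluations at the points of \<open>S\<close>.
  Since the coordinates of \<open>f\<close> are values of \<open>f\<close>, they are bounded by dual norms later on.\<close>

lemma interpolation_basis:
  fixes B :: "('v \<Rightarrow> 'k::field) set"
  assumes "finite B"
  obtains S :: "'v set" and e where "finite S" "\<And>s. s \<in> S \<Longrightarrow> e s \<in> fs.span B"
    "\<And>f. f \<in> fs.span B \<Longrightarrow> (\<Sum>s\<in>S. fscale (f s) (e s)) = f"
proof -
  have "\<exists>S e. finite S \<and> (\<forall>s\<in>S. e s \<in> fs.span B) \<and> (\<forall>s\<in>S. \<forall>t\<in>S. e s t = (if s = t then 1 else 0))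
      \<and> (\<forall>f\<in>fs.span B. (\<Sum>s\<in>S. fscale (f s) (e s)) = f)"
    using assms
  proof (induction B rule: finite_induct)
    case empty
    show ?case by (rule exI[of _ "{}"]) (simp del: zero_fun_apply)
  next
    case (insert g B)
    obtain S e where Se: "finite S \<and> (\<forall>s\<in>S. e s \<in> fs.span B)
        \<and> (\<forall>s\<in>S. \<forall>t\<in>S. e s t = (if s = t then 1 else 0))
        \<and> (\<forall>f\<in>fs.span B. (\<Sum>s\<in>S. fscale (f s) (e s)) = f)"
      using insert.IH by (elim exE) (rule that)
    then have S: "finite S" "\<And>s. s \<in> S \<Longrightarrow> e s \<in> fs.span B"
      and de: "\<And>s t. s \<in> S \<Longrightarrow> t \<in> S \<Longrightarrow> e s t = (if s = t then 1 else 0)"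
      and rep: "\<And>f. f \<in> fs.span B \<Longrightarrow> (\<Sum>s\<in>S. fscale (f s) (e s)) = f" by simp_all
    have sub: "fs.span B \<subseteq> fs.span (insert g B)" by (intro fs.span_mono) auto
    have gen: "\<forall>f\<in>fs.span (insert g B). (\<Sum>s\<in>T. fscale (f s) (d s)) = f"
      if T: "finite T" and "\<And>f. f \<in> insert g B \<Longrightarrow> (\<Sum>s\<in>T. fscale (f s) (d s)) = f" for T d
    proof -
      have "fs.subspace {f. (\<Sum>s\<in>T. fscale (f s) (d s)) = f}"
        by (rule fs.subspaceI)
           (auto simp: fs.scale_left_distrib sum.distrib fs.scale_sum_right fun_eq_iff fscale_apply sum_fun_apply
              distrib_right mult.assoc simp flip: sum_distrib_left)
      then have "fs.span (insert g B) \<subseteq> {f. (\<Sum>s\<in>T. fscale (f s) (d s)) = f}"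
        using that by (intro fs.span_minimal) auto
      then show ?thesis by auto
    qed
    \<comment> \<open>The remainder of \<open>g\<close> after interpolation at the old nodes. It
      vanishes at all of them, so if it is not zero, a point where it differs from 0 is a new
      node.\<close>
    define h where "h = g - (\<Sum>s\<in>S. fscale (g s) (e s))"
    have esp: "e s \<in> fs.span (insert g B)" if "s \<in> S" for s
      using S(2)[OF that] sub by (rule subsetD[rotated])
    have hsp: "h \<in> fs.span (insert g B)"
      unfolding h_def by (intro fs.span_diff fs.span_sum fs.span_scale esp fs.span_base) auto
    show ?case
    proof (cases "h = 0")
      case True
      have "(\<Sum>s\<in>S. fscale (f s) (e s)) = f" if "f \<in> insert g B" for f
        using that True rep[OF fs.span_base] by (auto simp: h_def)
      from gen[OF S(1) this] have "\<forall>f\<in>fs.span (insert g B). (\<Sum>s\<in>S. fscale (f s) (e s)) = f" by blast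
      then show ?thesis using S de sub by (intro exI[of _ S] exI[of _ e]) auto
    next
      case False
      then obtain t where t: "h t \<noteq> 0" by (auto simp: fun_eq_iff)
      have hS: "h r = 0" if "r \<in> S" for r
      proof -
        have "(\<Sum>s\<in>S. g s * e s r) = (\<Sum>s\<in>S. if s = r then g s else 0)"
          using that de by (intro sum.cong) auto
        then show ?thesis using that S(1) by (simp add: h_def fscale_apply sum_fun_apply)
      qed
      have tS: "t \<notin> S" using t hS by auto
      define u where "u = fscale (inverse (h t)) h"
      \<comment> \<open>Subtracting a multiple of \<open>u\<close> makes the old functions vanish at
        the new node \<open>t\<close>; as \<open>u\<close> vanishes on \<open>S\<close>, their
        values there are unchanged.\<close>
      define d where "d s = (if s = t then u else e s - fscale (e s t) u)" for s
      have usp: "u \<in> fs.span (insert g B)" unfolding u_def using hsp by (rule fs.span_scale)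
      have u: "u t = 1" "\<And>r. r \<in> S \<Longrightarrow> u r = 0" using t hS by (auto simp: u_def fscale_apply)
      \<comment> \<open>The new interpolant is the old one plus the multiple of \<open>u\<close>
        that repairs the value at \<open>t\<close>.\<close>
      have sum_d: "(\<Sum>s\<in>insert t S. fscale (f s) (d s))
          = (\<Sum>s\<in>S. fscale (f s) (e s)) + fscale (f t - (\<Sum>s\<in>S. fscale (f s) (e s)) t) u" for f
      proof -
        have "(\<Sum>s\<in>S. fscale (f s) (d s)) = (\<Sum>s\<in>S. fscale (f s) (e s - fscale (e s t) u))"
          using tS by (intro sum.cong) (auto simp: d_def)
        then show ?thesis
          using tS S(1)
          by (simp add: d_def fun_eq_iff fscale_apply sum_fun_apply algebra_simps sum_subtractf sum_distrib_left)
      qed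
      have "(\<Sum>s\<in>insert t S. fscale (f s) (d s)) = f" if "f \<in> insert g B" for f
      proof (cases "f = g")
        case True
        have "g t - (\<Sum>s\<in>S. fscale (g s) (e s)) t = h t" by (simp add: h_def)
        moreover have "fscale (h t) u = h" using t by (simp add: u_def)
        ultimately show ?thesis using True by (simp add: sum_d h_def[symmetric] del: plus_fun_apply) (simp add: h_def del: minus_apply)
      next
        case False
        then have "(\<Sum>s\<in>S. fscale (f s) (e s)) = f" using that by (intro rep fs.span_base) auto
                then show ?thesis by (simp add: sum_d del: plus_fun_apply)
      qed
      from gen[OF _ this] have "\<forall>f\<in>fs.span (insert g B). (\<Sum>s\<in>insert t S. fscale (f s) (d s)) = f"
        using S(1) by blast
      moreover have "d s \<in> fs.span (insert g B)" if "s \<in> insert t S" for s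
        using that S(2) sub usp unfolding d_def by (auto intro!: fs.span_diff fs.span_scale)
      moreover have "d s r = (if s = r then 1 else 0)" if "s \<in> insert t S" "r \<in> insert t S" for s r
        using that u de tS by (auto simp: d_def fscale_apply)
      ultimately show ?thesis using S(1) by (intro exI[of _ "insert t S"] exI[of _ d]) auto
    qed
  qed
  then show ?thesis using that by blast
qed

lemma interpolation_basis_dual_of:
  fixes M :: "('v::ab_group_add \<Rightarrow> 'k::real_normed_field) set"
  assumes "fin_dim_subspace fscale M" "M \<subseteq> dual_of V s n"
  obtains S e where "finite S" "S \<subseteq> V" "\<And>s. s \<in> S \<Longrightarrow> e s \<in> M"
    "\<And>f. f \<in> M \<Longrightarrow> (\<Sum>s\<in>S. fscale (f s) (e s)) = f"
proof -
  obtain B where B: "finite B" "M = fs.span B" using assms(1) by (auto simp: fin_dim_subspace_def)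
  obtain S e where S: "finite S" "\<And>s. s \<in> S \<Longrightarrow> e s \<in> M" "\<And>f. f \<in> M \<Longrightarrow> (\<Sum>s\<in>S. fscale (f s) (e s)) = f"
    using interpolation_basis[OF B(1)] unfolding B(2) by blast
  have "(\<Sum>s\<in>S \<inter> V. fscale (f s) (e s)) = f" if f: "f \<in> M" for f
  proof -
    have "(\<Sum>s\<in>S. fscale (f s) (e s)) = (\<Sum>s\<in>S \<inter> V. fscale (f s) (e s))"
      using S(1) f assms(2) by (intro sum.mono_neutral_right) (auto simp: dual_of_def)
    then show ?thesis using S(3)[OF f] by simp
  qed
  then show ?thesis using that[of "S \<inter> V" e] S by blast
qed

section \<open>Bounded functionals on a Banach space\<close>

definition bounded_op :: "('k \<Rightarrow> 'e \<Rightarrow> 'e) \<Rightarrow> ('e::real_normed_vector \<Rightarrow> 'e) \<Rightarrow> bool" where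
  "bounded_op s R \<longleftrightarrow> linear_map_on UNIV s s R \<and> (\<exists>C. \<forall>x. norm (R x) \<le> C * norm x)"

context banach_space_over
begin

sublocale E: seminormed_on UNIV scale norm
  by unfold_locales (simp_all add: norm_scale)

sublocale D: seminormed_on "dual scale" fscale dual_norm
  unfolding dual_def dual_norm_def by (rule E.seminormed_on_dual)

sublocale B: seminormed_on "bidual scale" fscale "bidual_norm scale"
  unfolding bidual_def bidual_norm_def by (rule D.seminormed_on_dual)

lemmas norm_le_dual_norm = E.norm_le_dual_norm_of[folded dual_def dual_norm_def, OF _ UNIV_I]
lemmas dual_norm_approx = E.dual_norm_of_approx[folded dual_def dual_norm_def]
lemmas norm_le_bidual_norm = D.norm_le_dual_norm_of[folded bidual_def bidual_norm_def]
lemmas bidual_norm_approx = D.dual_norm_of_approx[folded bidual_def bidual_norm_def]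
lemmas bidual_norm_add = D.dual_norm_of_add[folded bidual_def bidual_norm_def]
lemmas bidual_norm_sum = D.dual_norm_of_sum[folded bidual_def bidual_norm_def]

lemma subspace_dual: "fs.subspace (dual scale)"
  unfolding dual_def by (rule subspace_dual_of)

lemma dual_iff: "\<mu> \<in> dual scale \<longleftrightarrow> (\<forall>x y. \<mu> (x + y) = \<mu> x + \<mu> y) \<and> (\<forall>c x. \<mu> (scale c x) = c * \<mu> x)
    \<and> (\<exists>C. \<forall>x. norm (\<mu> x) \<le> C * norm x)"
  by (simp add: dual_def dual_of_def)

lemma dual_add: "\<mu> \<in> dual scale \<Longrightarrow> \<mu> (x + y) = \<mu> x + \<mu> y"
  and dual_scale: "\<mu> \<in> dual scale \<Longrightarrow> \<mu> (scale c x) = c * \<mu> x"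
  by (auto simp: dual_iff)

lemma dual_zero: "\<mu> \<in> dual scale \<Longrightarrow> \<mu> 0 = 0"
  using dual_scale[of \<mu> 0 0] by simp

lemma dual_diff: "\<mu> \<in> dual scale \<Longrightarrow> \<mu> (x - y) = \<mu> x - \<mu> y"
  using dual_add[of \<mu> "x - y" y] by simp

lemma dual_sum: "\<mu> \<in> dual scale \<Longrightarrow> \<mu> (\<Sum>i\<in>I. f i) = (\<Sum>i\<in>I. \<mu> (f i))"
  by (induction I rule: infinite_finite_induct) (auto simp: dual_add dual_zero)

lemma bidual_add: "\<Phi> \<in> bidual scale \<Longrightarrow> \<mu> \<in> dual scale \<Longrightarrow> \<nu> \<in> dual scale \<Longrightarrow> \<Phi> (\<mu> + \<nu>) = \<Phi> \<mu> + \<Phi> \<nu>"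
  and bidual_fscale: "\<Phi> \<in> bidual scale \<Longrightarrow> \<mu> \<in> dual scale \<Longrightarrow> \<Phi> (fscale c \<mu>) = c * \<Phi> \<mu>"
  by (auto simp: bidual_def dual_of_def)

lemma bidual_outside: "\<Phi> \<in> bidual scale \<Longrightarrow> \<mu> \<notin> dual scale \<Longrightarrow> \<Phi> \<mu> = 0"
  by (auto simp: bidual_def dual_of_def)

lemma bidual_sum:
  assumes "\<Phi> \<in> bidual scale" "\<And>i. i \<in> I \<Longrightarrow> \<mu> i \<in> dual scale"
  shows "\<Phi> (\<Sum>i\<in>I. \<mu> i) = (\<Sum>i\<in>I. \<Phi> (\<mu> i))"
  using assms(2)
proof (induction I rule: infinite_finite_induct)
  case (insert i I)
  then have "sum \<mu> I \<in> dual scale" by (intro fs.subspace_sum[OF subspace_dual]) auto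
  then show ?case using insert bidual_add[OF assms(1), of "\<mu> i" "sum \<mu> I"] by (simp del: plus_fun_apply)
qed (use bidual_fscale[OF assms(1) fs.subspace_0[OF subspace_dual], of 0] in auto)

lemma scaleR_conv_scale: "r *\<^sub>R x = scale (of_real r) x"
  by (simp add: scale_of_real)

text \<open>Here \<open>inner z 1\<close> is the real part of the scalar \<open>z\<close>.\<close>

lemma ex_dual_real_part:
  assumes add: "\<And>x y. f (x + y) = f x + f y" and sc: "\<And>r x. f (r *\<^sub>R x) = r * f x"
    and bd: "\<And>x. f x \<le> C * norm x"
  obtains \<phi> where "\<phi> \<in> dual scale" "\<And>x. inner (\<phi> x) 1 = f x"
proof -
  \<comment> \<open>Over the complex numbers, with basis 1 and i, this is the familiar
    \<open>f x - i f (i x)\<close>.\<close>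
  define \<phi> where "\<phi> x = (\<Sum>b\<in>Basis. f (scale (field_cnj b) x) *\<^sub>R b)" for x
  have inner_phi: "inner (\<phi> x) w = f (scale (field_cnj w) x)" for x w
  proof -
    define g where "g w = f (scale (field_cnj w) x)" for w
    have g: "linear g"
    proof (rule linearI)
      fix r w
      have "scale (field_cnj (r *\<^sub>R w)) x = r *\<^sub>R scale (field_cnj w) x"
        by (simp add: field_cnj_scaleR scaleR_conv_of_real[of r "field_cnj w"] scaleR_conv_scale)
      then show "g (r *\<^sub>R w) = r *\<^sub>R g w" by (simp add: g_def sc)
    qed (simp add: g_def field_cnj_add scale_left_distrib add)
    have "g w = g (\<Sum>b\<in>Basis. inner w b *\<^sub>R b)" by (simp add: euclidean_representation)
    also have "\<dots> = (\<Sum>b\<in>Basis. inner w b * g b)" using g by (simp add: linear_sum linear_scale)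
    also have "\<dots> = inner (\<phi> x) w"
      by (simp add: \<phi>_def g_def inner_sum_left inner_commute[of w] mult.commute)
    finally show ?thesis by (simp add: g_def)
  qed
  have ext: "z = z'" if "\<And>w. inner z w = inner z' w" for z z' :: 'k
    using that by (metis vector_eq_rdot)
  have "\<phi> (x + y) = \<phi> x + \<phi> y" for x y
    by (rule ext) (simp add: inner_phi inner_add_left scale_right_distrib add)
  moreover have "\<phi> (scale c x) = c * \<phi> x" for c x
  proof (rule ext)
    fix w
    have "inner (c * \<phi> x) w = inner (\<phi> x * field_cnj (field_cnj c * w)) 1"
      by (subst inner_eq_cnj) (simp add: field_cnj_mult ac_simps)
    also have "\<dots> = inner (\<phi> x) (field_cnj c * w)" by (rule inner_eq_cnj[symmetric])
    finally show "inner (\<phi> (scale c x)) w = inner (c * \<phi> x) w"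
      by (simp add: inner_phi field_cnj_mult mult.commute)
  qed
  moreover have "norm (\<phi> x) \<le> C * norm x" for x
  proof (cases "\<phi> x = 0")
    case True
    \<comment> \<open>Adding the bounds at \<open>x\<close> and at \<open>- x\<close> cancels the
      values of \<open>f\<close>.\<close>
    have "0 \<le> C * norm x"
      using bd[of x] bd[of "(-1) *\<^sub>R x"] by (simp only: sc) simp
    with True show ?thesis by simp
  next
    case False
    \<comment> \<open>Pairing \<open>\<phi> x\<close> with itself expresses the squared norm as one
      value of \<open>f\<close>, at a multiple of \<open>x\<close> whose scalar has norm
      \<open>norm (\<phi> x)\<close>; one factor then cancels.\<close>
    have "norm (\<phi> x) * norm (\<phi> x) = inner (\<phi> x) (\<phi> x)"
      by (simp add: dot_square_norm power2_eq_square)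
    also have "\<dots> \<le> C * (norm (\<phi> x) * norm x)"
      unfolding inner_phi using bd by (metis norm_scale norm_field_cnj)
    finally show ?thesis using False by (simp add: mult.left_commute)
  qed
  ultimately have "\<phi> \<in> dual scale" by (auto simp: dual_iff)
  moreover have "inner (\<phi> x) 1 = f x" for x
  proof -
    have "field_cnj (1::'k) = 1" by (simp add: field_cnj_def)
    then show ?thesis by (simp add: inner_phi)
  qed
  ultimately show ?thesis using that by blast
qed

text \<open>Mazur-Orlicz for the one-point set at \<open>x\<close> with threshold
  \<open>norm x\<close> yields a functional whose real part at \<open>x\<close> is at least
  \<open>norm x\<close>.\<close>

lemma dual_separates:
  assumes "\<And>\<mu>. \<mu> \<in> dual scale \<Longrightarrow> \<mu> x = 0"
  shows "x = 0"
proof -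
  interpret S: sublinear_functional "(*\<^sub>R) :: real \<Rightarrow> 'e \<Rightarrow> 'e" norm
    by unfold_locales (auto simp: sublinear_wrt_def norm_triangle_ineq scaleR_add_right scaleR_add_left)
  obtain f where f: "\<And>x y. f (x + y) = f x + f y" "\<And>t x. f (t *\<^sub>R x) = t * f x" "\<And>x. f x \<le> norm x"
    "norm x \<le> f x"
    by (rule S.mazur_orlicz[of "{x}" "norm x"]) (auto simp: scaleR_add_left[symmetric])
  obtain \<phi> where "\<phi> \<in> dual scale" "\<And>x. inner (\<phi> x) 1 = f x"
    using ex_dual_real_part[of f 1] f by auto
  with assms f(4) show ?thesis by (metis inner_zero_left norm_le_zero_iff)
qed

lemma comp_bounded_op: assumes "\<mu> \<in> dual scale" "bounded_op scale R" shows "\<mu> \<circ> R \<in> dual scale"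
proof -
  from assms(2) obtain C where C: "\<And>x. norm (R x) \<le> C * norm x" by (auto simp: bounded_op_def)
  have "norm (\<mu> (R x)) \<le> (dual_norm \<mu> * C) * norm x" for x
  proof -
    have "norm (\<mu> (R x)) \<le> dual_norm \<mu> * norm (R x)" by (rule norm_le_dual_norm[OF assms(1)])
    also have "\<dots> \<le> dual_norm \<mu> * (C * norm x)" using C D.n_nonneg[OF assms(1)] by (rule mult_left_mono)
    finally show ?thesis by (simp add: mult.assoc)
  qed
  then show ?thesis using assms by (auto simp: dual_iff bounded_op_def linear_map_on_def)
qed

text \<open>The real separating functional sees only real parts. Multiplying \<open>v\<close> by the
  unimodular scalar that turns \<open>\<phi> v\<close> into a positive real recovers the full
  norm.\<close>

lemma rotate_to_norm:
  assumes "\<phi> \<in> dual scale"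
  obtains w where "norm w \<le> norm v" "inner (\<phi> w) 1 = norm (\<phi> v)"
proof (cases "\<phi> v = 0")
  case True
  then show ?thesis using that[of v] by simp
next
  case False
  define z where "z = of_real (inverse (norm (\<phi> v))) * field_cnj (\<phi> v)"
  have "norm z = 1" using False by (simp add: z_def norm_mult norm_inverse)
  moreover have "z * \<phi> v = of_real (inverse (norm (\<phi> v)) * (norm (\<phi> v))\<^sup>2)"
    using field_cnj_mult_self[of "\<phi> v"] by (simp add: z_def mult.assoc mult.commute mult.left_commute)
  then have "z * \<phi> v = norm (\<phi> v) *\<^sub>R 1"
    using False by (simp add: power2_eq_square scaleR_conv_of_real)
  then have "inner (\<phi> (scale z v)) 1 = norm (\<phi> v)"
    by (simp add: dual_scale[OF assms] norm_eq_1[symmetric])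
  ultimately show ?thesis using that[of "scale z v"] by (simp add: norm_scale)
qed

text \<open>Otherwise a functional on a finite power of the space separates the affine set of exact
  solutions from the box of radius \<open>1 + \<delta>\<close>. Being constant on that set, it restricts on each
  unknown to an element of \<open>N\<close>, and so it can be evaluated at \<open>\<Phi>\<close>.\<close>

lemma bidual_solution_approx:
  fixes R :: "'c \<Rightarrow> 'i \<Rightarrow> 'e \<Rightarrow> 'e" and c :: "'c \<Rightarrow> 'e"
  assumes K: "finite K" and I: "finite I"
    and R: "\<And>k i. k \<in> K \<Longrightarrow> i \<in> I \<Longrightarrow> bounded_op scale (R k i)"
    and \<Phi>: "\<And>i. i \<in> I \<Longrightarrow> \<Phi> i \<in> bidual scale"
    and N: "fin_dim_subspace fscale N" "N \<subseteq> dual scale"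
    and bound: "\<And>k \<phi>. k \<in> K \<Longrightarrow> \<phi> \<in> dual scale \<Longrightarrow>
      norm (\<phi> (c k) + (\<Sum>i\<in>I. \<Phi> i (\<phi> \<circ> R k i))) \<le> dual_norm \<phi>"
    and \<delta>: "\<delta> > 0"
  obtains x where "\<And>i \<mu>. i \<in> I \<Longrightarrow> \<mu> \<in> N \<Longrightarrow> \<mu> (x i) = \<Phi> i \<mu>"
    "\<And>k. k \<in> K \<Longrightarrow> norm (c k + (\<Sum>i\<in>I. R k i (x i))) \<le> 1 + \<delta>"
proof (rule ccontr)
  assume no: "\<not> thesis"
  note solution = that
  define X where "X = {x. \<forall>i\<in>I. \<forall>\<mu>\<in>N. \<mu> (x i) = \<Phi> i \<mu>}"
  \<comment> \<open>The residual at each constraint. It is 0 outside \<open>K\<close>, so that a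
    functional on such families is a finite sum of its values on single entries.\<close>
  define y where "y x k = (if k \<in> K then c k + (\<Sum>i\<in>I. R k i (x i)) else 0)" for x k
  have viol: "\<exists>k\<in>K. 1 + \<delta> < norm (y x k)" if "x \<in> X" for x
  proof (rule ccontr)
    assume "\<not> ?thesis"
    then have thesis using that by (intro solution[of x]) (auto simp: X_def y_def not_less)
    with no show False ..
  qed
  obtain S e where S: "finite S" "\<And>s. s \<in> S \<Longrightarrow> e s \<in> N"
    "\<And>\<mu>. \<mu> \<in> N \<Longrightarrow> (\<Sum>s\<in>S. fscale (\<mu> s) (e s)) = \<mu>"
    using interpolation_basis_dual_of[OF N[unfolded dual_def]] by metis
  have Nsub: "fs.subspace N" using N(1) by (auto simp: fin_dim_subspace_def)
  \<comment> \<open>Interpolation in the predual direction: for \<open>\<mu>\<close> in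
    \<open>N\<close> and linear \<open>g\<close>, the value of \<open>\<mu>\<close> at
    \<open>proj g\<close> is \<open>g \<mu>\<close>. Applied to \<open>\<Phi> i\<close> this gives
    an exact solution; applied to evaluation at \<open>v\<close> it gives a vector that
    \<open>N\<close> cannot distinguish from \<open>v\<close>.\<close>
  define proj where "proj g = (\<Sum>s\<in>S. scale (g (e s)) s)" for g
  have proj: "\<mu> (proj g) = (\<Sum>s\<in>S. \<mu> s * g (e s))" if "\<mu> \<in> dual scale" for \<mu> g
    by (simp add: proj_def dual_sum[OF that] dual_scale[OF that] mult.commute)
  define x0 where "x0 i = proj (\<Phi> i)" for i
  have x0: "x0 \<in> X"
  proof -
    have "\<mu> (x0 i) = \<Phi> i \<mu>" if i: "i \<in> I" and \<mu>: "\<mu> \<in> N" for i \<mu>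
    proof -
      have "\<Phi> i (\<Sum>s\<in>S. fscale (\<mu> s) (e s)) = (\<Sum>s\<in>S. \<mu> s * \<Phi> i (e s))"
        using S(2) N(2) fs.subspace_scale[OF subspace_dual]
        by (subst bidual_sum[OF \<Phi>[OF i]]) (auto intro!: sum.cong bidual_fscale \<Phi> i)
      then show ?thesis using \<mu> N(2) S(3)[OF \<mu>] by (auto simp: x0_def proj)
    qed
    then show ?thesis by (simp add: X_def)
  qed
  \<comment> \<open>With no constraints, \<open>x0\<close> would already be a solution; the maximum
    below is therefore over a nonempty set.\<close>
  have Kne: "K \<noteq> {}" using viol[OF x0] by blast
  define sc where "sc = (\<lambda>(r::real) (u :: 'c \<Rightarrow> 'e) k. r *\<^sub>R u k)"
  define p where "p u = Max ((\<lambda>k. norm (u k)) ` K)" for u :: "'c \<Rightarrow> 'e"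
  have p_ge: "norm (u k) \<le> p u" if "k \<in> K" for u k
    unfolding p_def using K that by (intro Max_ge) auto
  have p_le: "p u \<le> a" if "\<And>k. k \<in> K \<Longrightarrow> norm (u k) \<le> a" for u a
    unfolding p_def using K Kne that by (intro Max.boundedI) auto
  interpret P: sublinear_functional sc p
  proof unfold_locales
    show "sublinear_wrt sc p"
      unfolding sublinear_wrt_def
    proof (intro conjI allI impI)
      show "p (u + v) \<le> p u + p v" for u v
        by (rule p_le) (simp add: norm_triangle_mono p_ge)
      show "p (sc t u) \<le> t * p u" if "t > 0" for t u
        by (rule p_le) (use that p_ge in \<open>simp add: sc_def\<close>)
    qed
  qed (auto simp: sc_def fun_eq_iff scaleR_add_right scaleR_add_left)
  have R_add: "R k i (v + w) = R k i v + R k i w" and R_scale: "R k i (scale z v) = scale z (R k i v)"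
    if "k \<in> K" "i \<in> I" for k i v w z
    using R[OF that] by (auto simp: bounded_op_def linear_map_on_def)
  have convX: "(\<lambda>i. s *\<^sub>R x i + (1 - s) *\<^sub>R x' i) \<in> X" if "x \<in> X" "x' \<in> X" for s x x'
  proof -
    have "\<mu> (s *\<^sub>R x i + (1 - s) *\<^sub>R x' i) = \<Phi> i \<mu>" if "i \<in> I" "\<mu> \<in> N" for i \<mu>
    proof -
      have "\<mu> \<in> dual scale" "\<mu> (x i) = \<Phi> i \<mu>" "\<mu> (x' i) = \<Phi> i \<mu>"
        using that N(2) \<open>x \<in> X\<close> \<open>x' \<in> X\<close> by (auto simp: X_def)
      then show ?thesis
        by (simp only: dual_add dual_scale scaleR_conv_scale) (simp add: algebra_simps)
    qed
    then show ?thesis by (simp add: X_def)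
  qed
  have convy: "sc s (y x) + sc (1 - s) (y x') = y (\<lambda>i. s *\<^sub>R x i + (1 - s) *\<^sub>R x' i)" for s x x'
  proof
    fix k
    show "(sc s (y x) + sc (1 - s) (y x')) k = y (\<lambda>i. s *\<^sub>R x i + (1 - s) *\<^sub>R x' i) k"
    proof (cases "k \<in> K")
      case True
      have "R k i (s *\<^sub>R x i + (1 - s) *\<^sub>R x' i) = s *\<^sub>R R k i (x i) + (1 - s) *\<^sub>R R k i (x' i)"
        if "i \<in> I" for i
        using that True by (simp add: R_add R_scale scaleR_conv_scale)
      then have "(\<Sum>i\<in>I. R k i (s *\<^sub>R x i + (1 - s) *\<^sub>R x' i))
          = s *\<^sub>R (\<Sum>i\<in>I. R k i (x i)) + (1 - s) *\<^sub>R (\<Sum>i\<in>I. R k i (x' i))"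
        by (simp add: sum.distrib scaleR_sum_right)
      then show ?thesis using True by (simp add: sc_def y_def algebra_simps)
    qed (simp add: sc_def y_def)
  qed
  \<comment> \<open>The residuals of exact solutions form a convex set on which the maximum norm is
    at least \<open>1 + \<delta>\<close>.\<close>
  obtain f where f: "\<And>u v. f (u + v) = f u + f v" "\<And>t u. f (sc t u) = t * f u" "\<And>u. f u \<le> p u"
    and f_ge: "\<And>x. x \<in> X \<Longrightarrow> 1 + \<delta> \<le> f (y x)"
  proof (rule P.mazur_orlicz[of "y ` X" "1 + \<delta>"])
    show "y ` X \<noteq> {}" using x0 by blast
    show "1 + \<delta> \<le> p u" if u: "u \<in> y ` X" for u
    proof -
      obtain x where "u = y x" "x \<in> X" using u by blast
      then obtain k where "k \<in> K" "1 + \<delta> < norm (u k)" using viol by blast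
      then show ?thesis using p_ge[of k u] by simp
    qed
    show "sc s u + sc (1 - s) v \<in> y ` X" if "u \<in> y ` X" "v \<in> y ` X" for u v s
      using that convX convy by auto
  qed blast
  define single where "single k v = (\<lambda>j. if j = k then v else (0::'e))" for k :: 'c and v
  have f_sum: "f (\<lambda>k. if k \<in> J then w k else 0) = (\<Sum>k\<in>J. f (single k (w k)))" if "finite J" for J w
    using that
  proof (induction J rule: finite_induct)
    case empty
    have "f 0 = 0" using f(1)[of 0 0] by simp
    then show ?case by (simp add: zero_fun_def)
  next
    case (insert k J)
    have "(\<lambda>j. if j \<in> insert k J then w j else 0) = single k (w k) + (\<lambda>j. if j \<in> J then w j else 0)"
      using insert by (auto simp: single_def fun_eq_iff)
    then show ?case using insert f(1) by simp
  qed
  have "\<exists>\<phi>. \<phi> \<in> dual scale \<and> (\<forall>v. inner (\<phi> v) 1 = f (single k v))" for k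
  proof -
    have 1: "single k (v + w) = single k v + single k w" for v w by (auto simp: single_def)
    have 2: "single k (r *\<^sub>R v) = sc r (single k v)" for r v by (auto simp: single_def sc_def)
    have 3: "f (single k v) \<le> 1 * norm v" for v
    proof -
      have "p (single k v) \<le> norm v" by (rule p_le) (simp add: single_def)
      then show ?thesis using f(3)[of "single k v"] by simp
    qed
    show ?thesis
      by (rule ex_dual_real_part[of "\<lambda>v. f (single k v)", OF _ _ 3]) (auto simp: 1 2 f)
  qed
  then obtain \<phi> where \<phi>: "\<And>k. \<phi> k \<in> dual scale" "\<And>k v. inner (\<phi> k v) 1 = f (single k v)" by metis
  have f_phi: "f (\<lambda>k. if k \<in> K then w k else 0) = inner (\<Sum>k\<in>K. \<phi> k (w k)) 1" for w
    by (simp add: f_sum[OF K] \<phi>(2) inner_sum_left)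
  \<comment> \<open>The pullback of the separating functional to the unknown with index
    \<open>i\<close>.\<close>
  define \<psi> where "\<psi> i = (\<Sum>k\<in>K. \<phi> k \<circ> R k i)" for i
  have comp: "\<phi> k \<circ> R k i \<in> dual scale" if "k \<in> K" "i \<in> I" for k i
    using R \<phi> that by (intro comp_bounded_op)
  have \<psi>: "\<psi> i \<in> dual scale" if "i \<in> I" for i
    unfolding \<psi>_def using comp that by (intro fs.subspace_sum[OF subspace_dual])
  have f_y: "f (y x) = inner ((\<Sum>k\<in>K. \<phi> k (c k)) + (\<Sum>i\<in>I. \<psi> i (x i))) 1" for x
  proof -
    have "(\<Sum>k\<in>K. \<phi> k (c k + (\<Sum>i\<in>I. R k i (x i))))
        = (\<Sum>k\<in>K. \<phi> k (c k)) + (\<Sum>k\<in>K. \<Sum>i\<in>I. \<phi> k (R k i (x i)))"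
      by (simp add: dual_add[OF \<phi>(1)] dual_sum[OF \<phi>(1)] sum.distrib)
    also have "(\<Sum>k\<in>K. \<Sum>i\<in>I. \<phi> k (R k i (x i))) = (\<Sum>i\<in>I. \<psi> i (x i))"
      by (subst sum.swap) (simp add: \<psi>_def sum_fun_apply)
    finally show ?thesis unfolding y_def f_phi by simp
  qed
  have ker: "\<psi> i d = 0" if i: "i \<in> I" and d: "\<And>\<mu>. \<mu> \<in> N \<Longrightarrow> \<mu> d = 0" for i d
  proof (rule eq_zero_if_inner_mult_zero)
    fix z
    define a where "a = inner (z * \<psi> i d) 1"
    define b where "b = f (y x0)"
    have le: "1 + \<delta> \<le> b + t * a" for t
    proof -
      \<comment> \<open>Moving one unknown in a direction killed by \<open>N\<close> stays inside
        \<open>X\<close>. The value of \<open>f\<close> is then affine in \<open>t\<close> and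
        bounded below, so its slope is 0: otherwise \<open>t = - b / a\<close> would make the value
        0.\<close>
      define x where "x = x0(i := x0 i + scale (of_real t * z) d)"
      have "x \<in> X"
        using x0 i d N(2) by (auto simp: X_def x_def dual_add dual_scale subset_iff)
      then have "1 + \<delta> \<le> f (y x)" by (rule f_ge)
      moreover have "(\<Sum>j\<in>I. \<psi> j (x j)) = (\<Sum>j\<in>I. \<psi> j (x0 j)) + of_real t * z * \<psi> i d"
      proof -
        have "(\<Sum>j\<in>I - {i}. \<psi> j (x j)) = (\<Sum>j\<in>I - {i}. \<psi> j (x0 j))"
          by (intro sum.cong) (auto simp: x_def)
        then show ?thesis
          using i I \<psi>[OF i] by (simp add: sum.remove[of I i] x_def dual_add dual_scale)
      qed
      moreover have "inner (of_real t * z * \<psi> i d) 1 = t * a"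
        unfolding a_def by (metis mult.assoc scaleR_conv_of_real inner_scaleR_left)
      ultimately show ?thesis by (simp add: f_y b_def inner_add_left)
    qed
    have "a = 0"
    proof (rule ccontr)
      assume "a \<noteq> 0"
      with le[of "- b / a"] \<delta> show False by simp
    qed
    then show "inner (z * \<psi> i d) 1 = 0" by (simp add: a_def)
  qed
  have \<psi>N: "\<psi> i \<in> N" if i: "i \<in> I" for i
  proof -
    have "\<psi> i v = (\<Sum>s\<in>S. fscale (\<psi> i s) (e s)) v" for v
    proof -
      \<comment> \<open>The interpolation error of \<open>v\<close> is killed by \<open>N\<close>,
        hence by \<open>\<psi> i\<close>. This writes \<open>\<psi> i\<close> as a combination of
        the elements \<open>e s\<close>.\<close>
      define d where "d = v - proj (\<lambda>g. g v)"
      have "\<mu> d = 0" if \<mu>: "\<mu> \<in> N" for \<mu>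
      proof -
        have "\<mu> v = (\<Sum>s\<in>S. fscale (\<mu> s) (e s)) v" using S(3)[OF \<mu>] by simp
        moreover have "\<mu> \<in> dual scale" using \<mu> N(2) by blast
        ultimately show ?thesis by (simp add: d_def dual_diff proj sum_fun_apply fscale_apply)
      qed
      then have "\<psi> i d = 0" by (rule ker[OF i])
      then show ?thesis
        using \<psi>[OF i] by (simp add: d_def dual_diff proj sum_fun_apply fscale_apply)
    qed
    then have "\<psi> i = (\<Sum>s\<in>S. fscale (\<psi> i s) (e s))" by (rule ext)
    moreover have "(\<Sum>s\<in>S. fscale (\<psi> i s) (e s)) \<in> N"
      using S(2) by (intro fs.subspace_sum[OF Nsub] fs.subspace_scale[OF Nsub])
    ultimately show ?thesis by simp
  qed
  have "1 + \<delta> \<le> (\<Sum>k\<in>K. dual_norm (\<phi> k))"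
  proof -
    \<comment> \<open>As each \<open>\<psi> i\<close> lies in \<open>N\<close>, the unknowns may be
      exchanged for the given elements of the bidual, and \<open>bound\<close> applies to the
      result.\<close>
    have "(\<Sum>i\<in>I. \<psi> i (x0 i)) = (\<Sum>i\<in>I. \<Phi> i (\<psi> i))"
      using x0 \<psi>N by (intro sum.cong) (auto simp: X_def)
    also have "\<dots> = (\<Sum>i\<in>I. \<Sum>k\<in>K. \<Phi> i (\<phi> k \<circ> R k i))"
      unfolding \<psi>_def by (intro sum.cong refl bidual_sum \<Phi> comp)
    also have "\<dots> = (\<Sum>k\<in>K. \<Sum>i\<in>I. \<Phi> i (\<phi> k \<circ> R k i))" by (rule sum.swap)
    finally have eq: "(\<Sum>k\<in>K. \<phi> k (c k)) + (\<Sum>i\<in>I. \<psi> i (x0 i))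
        = (\<Sum>k\<in>K. \<phi> k (c k) + (\<Sum>i\<in>I. \<Phi> i (\<phi> k \<circ> R k i)))" by (simp add: sum.distrib)
    have "1 + \<delta> \<le> f (y x0)" by (rule f_ge[OF x0])
    also have "\<dots> \<le> norm (\<Sum>k\<in>K. \<phi> k (c k) + (\<Sum>i\<in>I. \<Phi> i (\<phi> k \<circ> R k i)))"
      unfolding f_y eq using norm_cauchy_schwarz[of _ "1::'k"] by simp
    also have "\<dots> \<le> (\<Sum>k\<in>K. dual_norm (\<phi> k))" by (intro sum_norm_le bound \<phi>(1))
    finally show ?thesis .
  qed
  moreover have "(\<Sum>k\<in>K. dual_norm (\<phi> k)) \<le> 1 + \<delta> / 2"
  proof -
    \<comment> \<open>Nearly norming vectors, one for each constraint, form a family of maximum norm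
      at most 1, on which \<open>f\<close> is at most 1. The choice of \<open>\<eta>\<close> limits
      the total loss to \<open>\<delta> / 2\<close>.\<close>
    define \<eta> where "\<eta> = \<delta> / (2 * card K)"
    have cK: "card K > 0" using K Kne by (simp add: card_gt_0_iff)
    have \<eta>: "\<eta> > 0" using \<delta> cK by (simp add: \<eta>_def)
    have "\<exists>w. norm w \<le> 1 \<and> dual_norm (\<phi> k) - \<eta> \<le> inner (\<phi> k w) 1" for k
    proof -
      obtain v where "norm v \<le> 1" "dual_norm (\<phi> k) - \<eta> < norm (\<phi> k v)"
        using dual_norm_approx[OF \<phi>(1) \<eta>] by blast
      moreover obtain w where "norm w \<le> norm v" "inner (\<phi> k w) 1 = norm (\<phi> k v)"
        using rotate_to_norm[OF \<phi>(1)] by blast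
      ultimately show ?thesis by (intro exI[of _ w]) simp
    qed
    then obtain w where w: "\<And>k. norm (w k) \<le> 1" "\<And>k. dual_norm (\<phi> k) - \<eta> \<le> inner (\<phi> k (w k)) 1"
      by metis
    have "(\<Sum>k\<in>K. dual_norm (\<phi> k) - \<eta>) \<le> (\<Sum>k\<in>K. inner (\<phi> k (w k)) 1)"
      by (intro sum_mono w)
    also have "\<dots> = f (\<lambda>k. if k \<in> K then w k else 0)" by (simp add: f_phi inner_sum_left)
    also have "\<dots> \<le> 1" using f(3) p_le w(1) by (smt (verit) norm_zero)
    finally have "(\<Sum>k\<in>K. dual_norm (\<phi> k)) \<le> 1 + card K * \<eta>" by (simp add: sum_subtractf)
    also have "card K * \<eta> = \<delta> / 2" using cK by (simp add: \<eta>_def)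
    finally show ?thesis .
  qed
  ultimately show False using \<delta> by simp
qed

end

section \<open>Local reflexivity\<close>

text \<open>The second adjoint of \<open>R\<close>. With the algebra element fixed, it describes the
  left and the right action on the bidual alike.\<close>

definition bidual_op :: "('k::real_normed_field \<Rightarrow> 'e::real_normed_vector \<Rightarrow> 'e) \<Rightarrow> ('e \<Rightarrow> 'e)
    \<Rightarrow> (('e \<Rightarrow> 'k) \<Rightarrow> 'k) \<Rightarrow> ('e \<Rightarrow> 'k) \<Rightarrow> 'k" where
  "bidual_op s R \<Phi> = restr (dual s) (\<lambda>\<mu>. \<Phi> (\<mu> \<circ> R))"

section \<open>The canonical embedding and the finite system of constraints for
  \<open>T\<close>\<close>

context banach_space_over
begin

lemma canonical_embedding_apply: "\<mu> \<in> dual scale \<Longrightarrow> canonical_embedding scale x \<mu> = \<mu> x"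
  by (simp add: canonical_embedding_def restr_def)

lemma canonical_embedding_add:
  "canonical_embedding scale (x + y) = canonical_embedding scale x + canonical_embedding scale y"
  by (auto simp: canonical_embedding_def restr_def fun_eq_iff dual_add)

lemma canonical_embedding_scale:
  "canonical_embedding scale (scale a x) = fscale a (canonical_embedding scale x)"
  by (auto simp: canonical_embedding_def restr_def fun_eq_iff dual_scale fscale_apply)

lemma canonical_embedding_sum:
  "canonical_embedding scale (\<Sum>i\<in>I. f i) = (\<Sum>i\<in>I. canonical_embedding scale (f i))"
proof (induction I rule: infinite_finite_induct)
  case (insert i I)
  then show ?case by (simp add: canonical_embedding_add del: plus_fun_apply)
qed (auto simp: canonical_embedding_def restr_def fun_eq_iff dual_zero)

lemma canonical_embedding_inject:
  assumes "canonical_embedding scale x = canonical_embedding scale y"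
  shows "x = y"
proof -
  have "x - y = 0"
  proof (rule dual_separates)
    fix \<mu> assume "\<mu> \<in> dual scale"
    then show "\<mu> (x - y) = 0" using assms canonical_embedding_apply[of \<mu>] by (metis dual_diff diff_self)
  qed
  then show ?thesis by simp
qed

lemma canonical_embedding_in_bidual: "canonical_embedding scale x \<in> bidual scale"
proof -
  have "norm (canonical_embedding scale x \<mu>) \<le> norm x * dual_norm \<mu>" if "\<mu> \<in> dual scale" for \<mu>
    using norm_le_dual_norm[OF that, of x] that by (simp add: canonical_embedding_apply mult.commute)
  moreover have "\<mu> + \<nu> \<in> dual scale" if "\<mu> \<in> dual scale" "\<nu> \<in> dual scale" for \<mu> \<nu>
    using that by (rule fs.subspace_add[OF subspace_dual])
  moreover have "fscale a \<mu> \<in> dual scale" if "\<mu> \<in> dual scale" for a \<mu>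
    using that by (rule fs.subspace_scale[OF subspace_dual])
  ultimately show ?thesis
    unfolding bidual_def dual_of_def
    by (auto simp: canonical_embedding_def restr_def fscale_apply simp del: plus_fun_apply)
       (simp_all add: plus_fun_apply)
qed

lemma bidual_norm_eq_0:
  assumes "\<Phi> \<in> bidual scale" "bidual_norm scale \<Phi> = 0"
  shows "\<Phi> = 0"
proof
  fix \<mu>
  show "\<Phi> \<mu> = 0 \<mu>"
    using norm_le_bidual_norm[OF assms(1), of \<mu>] bidual_outside[OF assms(1), of \<mu>] assms(2)
    by (cases "\<mu> \<in> dual scale") auto
qed

lemma bidual_diff:
  assumes "\<Phi> \<in> bidual scale" "\<mu> \<in> dual scale" "\<nu> \<in> dual scale"
  shows "\<Phi> (\<mu> - \<nu>) = \<Phi> \<mu> - \<Phi> \<nu>"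
  using bidual_add[OF assms(1) fs.subspace_diff[OF subspace_dual assms(2,3)] assms(3)]
  by (simp del: plus_fun_apply minus_apply)

lemma bounded_op_add: "bounded_op scale R \<Longrightarrow> R (x + y) = R x + R y"
  and bounded_op_scale: "bounded_op scale R \<Longrightarrow> R (scale a x) = scale a (R x)"
  by (auto simp: bounded_op_def linear_map_on_def)

lemma bounded_op_sum: assumes "bounded_op scale R" shows "R (\<Sum>i\<in>I. f i) = (\<Sum>i\<in>I. R (f i))"
proof (induction I rule: infinite_finite_induct)
  case (insert i I)
  then show ?case by (simp add: bounded_op_add[OF assms])
qed (use bounded_op_scale[OF assms, of 0] in auto)

lemma bounded_op_scale_combination:
  assumes "bounded_op scale R"
  shows "bounded_op scale (\<lambda>x. scale q (scale a (R x) - scale b x))"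
proof -
  obtain C where C: "\<And>x. norm (R x) \<le> C * norm x" using assms by (auto simp: bounded_op_def)
  have "norm (scale q (scale a (R x) - scale b x)) \<le> (norm q * (norm a * C + norm b)) * norm x" for x
  proof -
    have "norm (scale a (R x) - scale b x) \<le> norm a * norm (R x) + norm b * norm x"
      by (metis norm_scale norm_triangle_ineq4)
    also have "\<dots> \<le> norm a * (C * norm x) + norm b * norm x"
      using C by (intro add_mono mult_left_mono) auto
    finally show ?thesis
      unfolding norm_scale by (simp add: mult_left_mono distrib_right mult.assoc)
  qed
  then have "\<exists>C. \<forall>x. norm (scale q (scale a (R x) - scale b x)) \<le> C * norm x" by blast
  moreover have "linear_map_on UNIV scale scale (\<lambda>x. scale q (scale a (R x) - scale b x))"
    by (simp add: linear_map_on_def bounded_op_add[OF assms] bounded_op_scale[OF assms]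
        scale_right_distrib scale_right_diff_distrib mult.commute mult.left_commute)
  ultimately show ?thesis by (simp add: bounded_op_def)
qed

lemma bounded_op_scale_const: "bounded_op scale (scale a)"
proof -
  have "\<exists>C. \<forall>x. norm (scale a x) \<le> C * norm x" by (intro exI[of _ "norm a"]) (simp add: norm_scale)
  then show ?thesis
    by (simp add: bounded_op_def linear_map_on_def scale_right_distrib mult.commute)
qed

text \<open>The map \<open>T\<close> here is the prescribed part of the final one, carried by the
  basis vectors from the range of the embedding. The free coordinates \<open>c\<close> vanish on
  that range, so any vectors substituted for the elements of \<open>I\<close> leave the values there
  unchanged.\<close>

lemma bidual_decomposition:
  fixes M\<^sub>0 :: "(('e \<Rightarrow> 'k) \<Rightarrow> 'k) set"
  assumes M0: "fin_dim_subspace fscale M\<^sub>0"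
  obtains I c T where "finite I" "I \<subseteq> M\<^sub>0" "linear_map_on M\<^sub>0 fscale scale T"
    "\<And>i. linear_map_on M\<^sub>0 fscale (*) (\<lambda>\<Phi>. c \<Phi> i)"
    "\<And>\<Phi> \<mu>. \<Phi> \<in> M\<^sub>0 \<Longrightarrow> \<mu> \<in> dual scale \<Longrightarrow> \<Phi> \<mu> = \<mu> (T \<Phi>) + (\<Sum>i\<in>I. c \<Phi> i * i \<mu>)"
    "\<And>x. canonical_embedding scale x \<in> M\<^sub>0 \<Longrightarrow> T (canonical_embedding scale x) = x"
    "\<And>x i. canonical_embedding scale x \<in> M\<^sub>0 \<Longrightarrow> i \<in> I \<Longrightarrow> c (canonical_embedding scale x) i = 0"
proof -
  obtain B0 where B0: "finite B0" "M\<^sub>0 = fs.span B0" using M0 by (auto simp: fin_dim_subspace_def)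
  define V where "V = M\<^sub>0 \<inter> range (canonical_embedding scale)"
  obtain B1 where B1: "B1 \<subseteq> V" "fs.independent B1" "V \<subseteq> fs.span B1"
    using fs.maximal_independent_subset by blast
  then have "B1 \<subseteq> M\<^sub>0" by (auto simp: V_def)
  then obtain B where B: "B1 \<subseteq> B" "B \<subseteq> M\<^sub>0" "fs.independent B" "M\<^sub>0 \<subseteq> fs.span B"
    using fs.maximal_independent_subset_extend[OF _ B1(2)] by metis
  have finB: "finite B" using fs.independent_span_bound[OF B0(1) B(3)] B(2) B0(2) by blast
  have inB: "\<Phi> \<in> fs.span B" if "\<Phi> \<in> M\<^sub>0" for \<Phi> using that B(4) by blast
  have "\<exists>g. \<forall>b\<in>B1. canonical_embedding scale (g b) = b"
    using B1(1) by (intro bchoice) (auto simp: V_def)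
  then obtain g where g: "\<And>b. b \<in> B1 \<Longrightarrow> canonical_embedding scale (g b) = b" by blast
  define c where "c = fs.representation B"
  define T where "T \<Phi> = (\<Sum>b\<in>B1. scale (c \<Phi> b) (g b))" for \<Phi>
  have c_lin: "linear_map_on M\<^sub>0 fscale (*) (\<lambda>\<Phi>. c \<Phi> i)" for i
    by (simp add: linear_map_on_def c_def fs.representation_add[OF B(3) inB inB]
        fs.representation_scale[OF B(3) inB] del: plus_fun_apply)
  have T_lin: "linear_map_on M\<^sub>0 fscale scale T"
    using c_lin by (simp add: linear_map_on_def T_def scale_left_distrib sum.distrib scale_sum_right
        del: plus_fun_apply)
  have repr: "\<Phi> \<mu> = \<mu> (T \<Phi>) + (\<Sum>i\<in>B - B1. c \<Phi> i * i \<mu>)" if "\<Phi> \<in> M\<^sub>0" "\<mu> \<in> dual scale" for \<Phi> \<mu>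
  proof -
    have "\<Phi> \<mu> = (\<Sum>b\<in>B. fscale (c \<Phi> b) b) \<mu>"
      unfolding c_def using fs.sum_representation_eq[OF B(3) inB[OF that(1)] finB order_refl] by simp
    also have "\<dots> = (\<Sum>b\<in>B. c \<Phi> b * b \<mu>)" by (simp add: sum_fun_apply fscale_apply)
    also have "\<dots> = (\<Sum>b\<in>B1. c \<Phi> b * b \<mu>) + (\<Sum>b\<in>B - B1. c \<Phi> b * b \<mu>)"
      using sum.subset_diff[OF B(1) finB] by (simp add: add.commute)
    also have "(\<Sum>b\<in>B1. c \<Phi> b * b \<mu>) = (\<Sum>b\<in>B1. c \<Phi> b * \<mu> (g b))"
      using g canonical_embedding_apply[OF that(2)] by (intro sum.cong) (metis, metis)
    also have "\<dots> = \<mu> (T \<Phi>)" by (simp add: T_def dual_sum[OF that(2)] dual_scale[OF that(2)])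
    finally show ?thesis .
  qed
  have c0: "c (canonical_embedding scale x) i = 0"
    if x: "canonical_embedding scale x \<in> M\<^sub>0" and i: "i \<in> B - B1" for x i
  proof -
    \<comment> \<open>An element of the smaller span has the same coordinates in the extended basis,
      hence none along the added vectors.\<close>
    have "canonical_embedding scale x \<in> fs.span B1" using x B1(3) by (auto simp: V_def)
    then have "c (canonical_embedding scale x) = fs.representation B1 (canonical_embedding scale x)"
      unfolding c_def by (rule fs.representation_extend[OF B(3) _ B(1)])
    then show ?thesis using i fs.representation_ne_zero by (metis DiffD2)
  qed
  have "T (canonical_embedding scale x) = x" if x: "canonical_embedding scale x \<in> M\<^sub>0" for x
  proof -
    have "x - T (canonical_embedding scale x) = 0"
    proof (rule dual_separates)
      fix \<mu> assume \<mu>: "\<mu> \<in> dual scale"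
      have "\<mu> x = \<mu> (T (canonical_embedding scale x))"
        using repr[OF x \<mu>] c0[OF x] canonical_embedding_apply[OF \<mu>, of x] by simp
      then show "\<mu> (x - T (canonical_embedding scale x)) = 0" by (simp add: dual_diff[OF \<mu>])
    qed
    then show ?thesis by simp
  qed
  then show ?thesis
    by (intro that[of "B - B1" T c] T_lin c_lin repr c0) (use finB B(2) in auto)
qed

text \<open>Every inequality is encoded as a pair \<open>k\<close>: the operators
  \<open>fst k\<close> act on the unknowns and \<open>snd k\<close> is the constant contributed by
  the prescribed part. The elements of \<open>I\<close>, put in place of the unknowns, satisfy the
  system in the bidual.\<close>

lemma local_reflexivity_finite:
  fixes M\<^sub>0 :: "(('e \<Rightarrow> 'k) \<Rightarrow> 'k) set"
  assumes M0: "fin_dim_subspace fscale M\<^sub>0" "M\<^sub>0 \<subseteq> bidual scale"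
    and N: "fin_dim_subspace fscale N" "N \<subseteq> dual scale"
    and F: "finite F" "F \<subseteq> M\<^sub>0"
    and D: "finite D" "\<And>R \<Phi>. (R, \<Phi>) \<in> D \<Longrightarrow> bounded_op scale R \<and> \<Phi> \<in> M\<^sub>0 \<and> bidual_op scale R \<Phi> \<in> M\<^sub>0"
    and \<delta>: "\<delta> > 0" and \<gamma>: "\<gamma> > 0"
  obtains T where "linear_map_on M\<^sub>0 fscale scale T"
    "\<And>\<Phi> \<mu>. \<Phi> \<in> M\<^sub>0 \<Longrightarrow> \<mu> \<in> N \<Longrightarrow> \<Phi> \<mu> = \<mu> (T \<Phi>)"
    "\<And>x. canonical_embedding scale x \<in> M\<^sub>0 \<Longrightarrow> T (canonical_embedding scale x) = x"
    "\<And>\<Phi>. \<Phi> \<in> F \<Longrightarrow> norm (T \<Phi>) \<le> (1 + \<delta>) * bidual_norm scale \<Phi>"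
    "\<And>R \<Phi>. (R, \<Phi>) \<in> D \<Longrightarrow> norm (R (T \<Phi>) - T (bidual_op scale R \<Phi>)) \<le> \<gamma>"
proof -
  obtain I c T1 where I: "finite I" "I \<subseteq> M\<^sub>0" and T1: "linear_map_on M\<^sub>0 fscale scale T1"
    and c: "\<And>i. linear_map_on M\<^sub>0 fscale (*) (\<lambda>\<Phi>. c \<Phi> i)"
    and repr: "\<And>\<Phi> \<mu>. \<Phi> \<in> M\<^sub>0 \<Longrightarrow> \<mu> \<in> dual scale \<Longrightarrow> \<Phi> \<mu> = \<mu> (T1 \<Phi>) + (\<Sum>i\<in>I. c \<Phi> i * i \<mu>)"
    and T1_emb: "\<And>x. canonical_embedding scale x \<in> M\<^sub>0 \<Longrightarrow> T1 (canonical_embedding scale x) = x"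
    and c_emb: "\<And>x i. canonical_embedding scale x \<in> M\<^sub>0 \<Longrightarrow> i \<in> I \<Longrightarrow> c (canonical_embedding scale x) i = 0"
    by (rule bidual_decomposition[OF M0(1)]) (rule that)
  have Ib: "i \<in> bidual scale" if "i \<in> I" for i using that I(2) M0(2) by blast
  \<comment> \<open>Normalises \<open>\<Phi>\<close> to norm at most 1. For a \<open>\<Phi>\<close>
    of norm 0 the inverse is 0 and the constraint becomes trivial; \<open>T \<Phi> = 0\<close> is
    then obtained from linearity.\<close>
  define h where "h \<Phi> = (of_real (inverse (bidual_norm scale \<Phi>)) :: 'k)" for \<Phi>
  \<comment> \<open>The system is solved up to \<open>1 + \<delta>\<close>, so this factor leaves a
    defect of at most \<open>\<gamma>\<close>. In the bidual the defect is 0, and any factor is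
    admissible.\<close>
  define q where "q = (of_real ((1 + \<delta>) / \<gamma>) :: 'k)"
  define cF where "cF \<Phi> = ((\<lambda>i. scale (h \<Phi> * c \<Phi> i)), scale (h \<Phi>) (T1 \<Phi>))" for \<Phi>
  define cD where "cD = (\<lambda>(R, \<Phi>). ((\<lambda>i x. scale q (scale (c \<Phi> i) (R x) - scale (c (bidual_op scale R \<Phi>) i) x)),
      scale q (R (T1 \<Phi>) - T1 (bidual_op scale R \<Phi>))))"
  define K where "K = cF ` F \<union> cD ` D"
  obtain x where x_N: "\<And>i \<mu>. i \<in> I \<Longrightarrow> \<mu> \<in> N \<Longrightarrow> \<mu> (x i) = i \<mu>"
    and x_K: "\<And>k. k \<in> K \<Longrightarrow> norm (snd k + (\<Sum>i\<in>I. fst k i (x i))) \<le> 1 + \<delta>"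
  proof (rule bidual_solution_approx[of K I fst "\<lambda>i. i" N snd \<delta>])
    show "finite K" using F D by (simp add: K_def)
    show "bounded_op scale (fst k i)" if "k \<in> K" for k i
      using that D(2) bounded_op_scale_const bounded_op_scale_combination
      by (auto simp: K_def cF_def cD_def)
    show "norm (\<phi> (snd k) + (\<Sum>i\<in>I. i (\<phi> \<circ> fst k i))) \<le> dual_norm \<phi>"
      if k: "k \<in> K" and \<phi>: "\<phi> \<in> dual scale" for k \<phi>
    proof -
      consider \<Phi> where "\<Phi> \<in> F" "k = cF \<Phi>" | R \<Phi> where "(R, \<Phi>) \<in> D" "k = cD (R, \<Phi>)"
        using k by (auto simp: K_def)
      then show ?thesis
      proof cases
        case 1
        then have \<Phi>: "\<Phi> \<in> M\<^sub>0" using F by blast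
        have comp_scale: "\<phi> \<circ> scale z = fscale z \<phi>" for z
          using \<phi> by (auto simp: fun_eq_iff dual_scale fscale_apply)
        have "i (\<phi> \<circ> fst k i) = h \<Phi> * (c \<Phi> i * i \<phi>)" if "i \<in> I" for i
          using bidual_fscale[OF Ib[OF that] \<phi>] by (simp add: 1 cF_def comp_scale)
        then have "(\<Sum>i\<in>I. i (\<phi> \<circ> fst k i)) = h \<Phi> * (\<Sum>i\<in>I. c \<Phi> i * i \<phi>)"
          unfolding sum_distrib_left by (rule sum.cong[OF refl])
        then have "\<phi> (snd k) + (\<Sum>i\<in>I. i (\<phi> \<circ> fst k i))
            = h \<Phi> * (\<phi> (T1 \<Phi>) + (\<Sum>i\<in>I. c \<Phi> i * i \<phi>))"
          using \<phi> by (simp add: 1 cF_def dual_scale distrib_left)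
        also have "\<dots> = h \<Phi> * \<Phi> \<phi>" using repr[OF \<Phi> \<phi>] by simp
        finally have "norm (\<phi> (snd k) + (\<Sum>i\<in>I. i (\<phi> \<circ> fst k i)))
            = inverse \<bar>bidual_norm scale \<Phi>\<bar> * norm (\<Phi> \<phi>)"
          by (simp add: h_def norm_mult norm_inverse)
        also have "\<dots> \<le> inverse \<bar>bidual_norm scale \<Phi>\<bar> * (bidual_norm scale \<Phi> * dual_norm \<phi>)"
          using norm_le_bidual_norm[OF _ \<phi>] \<Phi> M0(2) by (intro mult_left_mono) auto
        also have "\<dots> \<le> dual_norm \<phi>"
        proof -
          have "\<Phi> \<in> bidual scale" using \<Phi> M0(2) by blast
          then show ?thesis using B.n_nonneg D.n_nonneg[OF \<phi>]
            by (cases "bidual_norm scale \<Phi> = 0") (simp_all flip: mult.assoc)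
        qed
        finally show ?thesis .
      next
        case 2
        define \<Psi> where "\<Psi> = bidual_op scale R \<Phi>"
        have R: "bounded_op scale R" and \<Phi>: "\<Phi> \<in> M\<^sub>0" and \<Psi>: "\<Psi> \<in> M\<^sub>0"
          using D(2)[OF 2(1)] by (auto simp: \<Psi>_def)
        have \<phi>R: "\<phi> \<circ> R \<in> dual scale" using \<phi> R by (rule comp_bounded_op)
        have "i (\<phi> \<circ> fst k i) = q * (c \<Phi> i * i (\<phi> \<circ> R) - c \<Psi> i * i \<phi>)" if "i \<in> I" for i
        proof -
          have "\<phi> \<circ> fst k i = fscale q (fscale (c \<Phi> i) (\<phi> \<circ> R) - fscale (c \<Psi> i) \<phi>)"
            using \<phi> by (auto simp: 2 cD_def \<Psi>_def fun_eq_iff dual_scale dual_diff fscale_apply)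
          then show ?thesis
            using \<phi> \<phi>R fs.subspace_diff[OF subspace_dual] fs.subspace_scale[OF subspace_dual]
            by (simp add: bidual_fscale[OF Ib[OF that]] bidual_diff[OF Ib[OF that]] del: minus_apply)
        qed
        then have "(\<Sum>i\<in>I. i (\<phi> \<circ> fst k i)) = (\<Sum>i\<in>I. q * (c \<Phi> i * i (\<phi> \<circ> R) - c \<Psi> i * i \<phi>))"
          by (rule sum.cong[OF refl])
        also have "\<dots> = q * ((\<Sum>i\<in>I. c \<Phi> i * i (\<phi> \<circ> R)) - (\<Sum>i\<in>I. c \<Psi> i * i \<phi>))"
          by (simp add: sum_subtractf sum_distrib_left right_diff_distrib)
        finally have "(\<Sum>i\<in>I. i (\<phi> \<circ> fst k i))
            = q * ((\<Sum>i\<in>I. c \<Phi> i * i (\<phi> \<circ> R)) - (\<Sum>i\<in>I. c \<Psi> i * i \<phi>))" .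
        moreover have "\<phi> (snd k) = q * ((\<phi> \<circ> R) (T1 \<Phi>) - \<phi> (T1 \<Psi>))"
          using \<phi> by (simp add: 2 cD_def \<Psi>_def dual_scale dual_diff)
        \<comment> \<open>By the decompositions of \<open>\<Phi>\<close> at
          \<open>\<phi> \<circ> R\<close> and of \<open>\<Psi>\<close> at \<open>\<phi>\<close>, the
          expression is the defect in the bidual, which vanishes because \<open>\<Psi>\<close> is
          the second adjoint of \<open>R\<close> at \<open>\<Phi>\<close>.\<close>
        ultimately have "\<phi> (snd k) + (\<Sum>i\<in>I. i (\<phi> \<circ> fst k i)) = q * (\<Phi> (\<phi> \<circ> R) - \<Psi> \<phi>)"
          unfolding repr[OF \<Phi> \<phi>R] repr[OF \<Psi> \<phi>] by (simp add: algebra_simps)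
        also have "\<dots> = 0" using \<phi> by (simp add: \<Psi>_def bidual_op_def restr_def)
        finally show ?thesis using D.n_nonneg[OF \<phi>] by simp
      qed
    qed
  qed (use I N Ib \<delta> in auto)
  define T where "T \<Phi> = T1 \<Phi> + (\<Sum>i\<in>I. scale (c \<Phi> i) (x i))" for \<Phi>
  have T_lin: "linear_map_on M\<^sub>0 fscale scale T"
    using c T1 by (simp add: linear_map_on_def T_def scale_left_distrib scale_right_distrib
        sum.distrib scale_sum_right del: plus_fun_apply)
  moreover have "\<Phi> \<mu> = \<mu> (T \<Phi>)" if "\<Phi> \<in> M\<^sub>0" "\<mu> \<in> N" for \<Phi> \<mu>
  proof -
    have "\<mu> \<in> dual scale" using that N by blast
    moreover have "(\<Sum>i\<in>I. c \<Phi> i * i \<mu>) = (\<Sum>i\<in>I. c \<Phi> i * \<mu> (x i))"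
      by (rule sum.cong[OF refl]) (metis that(2) x_N)
    ultimately show ?thesis
      using repr[of \<Phi> \<mu>] that(1) by (simp add: T_def dual_add dual_sum dual_scale)
  qed
  moreover have "T (canonical_embedding scale y) = y" if "canonical_embedding scale y \<in> M\<^sub>0" for y
    using that by (simp add: T_def T1_emb c_emb)
  moreover have "norm (T \<Phi>) \<le> (1 + \<delta>) * bidual_norm scale \<Phi>" if \<Phi>: "\<Phi> \<in> F" for \<Phi>
  proof (cases "bidual_norm scale \<Phi> = 0")
    case True
    then have "\<Phi> = fscale 0 0" using bidual_norm_eq_0 \<Phi> F(2) M0(2) by auto
    moreover have "fscale 0 0 \<in> M\<^sub>0" using calculation \<Phi> F(2) by auto
    ultimately have "T \<Phi> = scale 0 (T 0)" using T_lin by (metis linear_map_on_def fs.scale_zero_left)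
    then show ?thesis using True by simp
  next
    case False
    then have pos: "bidual_norm scale \<Phi> > 0"
      using B.n_nonneg[of \<Phi>] \<Phi> F(2) M0(2) by (metis order_less_le subsetD)
    have "snd (cF \<Phi>) + (\<Sum>i\<in>I. fst (cF \<Phi>) i (x i)) = scale (h \<Phi>) (T \<Phi>)"
      by (simp add: cF_def T_def scale_right_distrib scale_sum_right)
    then have "norm (scale (h \<Phi>) (T \<Phi>)) \<le> 1 + \<delta>" using x_K[of "cF \<Phi>"] \<Phi> by (simp add: K_def)
    moreover have "norm (h \<Phi>) = inverse (bidual_norm scale \<Phi>)" using pos by (simp add: h_def norm_inverse)
    ultimately show ?thesis using pos by (simp add: norm_scale field_simps)
  qed
  moreover have "norm (R (T \<Phi>) - T (bidual_op scale R \<Phi>)) \<le> \<gamma>" if RP: "(R, \<Phi>) \<in> D" for R \<Phi>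
  proof -
    have R: "bounded_op scale R" using D(2)[OF RP] by simp
    have "snd (cD (R, \<Phi>)) + (\<Sum>i\<in>I. fst (cD (R, \<Phi>)) i (x i))
        = scale q (R (T \<Phi>) - T (bidual_op scale R \<Phi>))"
      by (simp add: cD_def T_def bounded_op_add[OF R] bounded_op_sum[OF R] bounded_op_scale[OF R]
          scale_right_distrib scale_right_diff_distrib scale_sum_right sum_subtractf)
    then have "norm (scale q (R (T \<Phi>) - T (bidual_op scale R \<Phi>))) \<le> 1 + \<delta>"
      using x_K[of "cD (R, \<Phi>)"] RP by (simp add: K_def)
    moreover have "norm q = (1 + \<delta>) / \<gamma>" using \<delta> \<gamma> by (simp only: q_def norm_of_real) simp
    ultimately have "(1 + \<delta>) * norm (R (T \<Phi>) - T (bidual_op scale R \<Phi>)) \<le> (1 + \<delta>) * \<gamma>"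
      using \<gamma> unfolding norm_scale by (simp add: pos_divide_le_eq)
    then show ?thesis using \<delta> by simp
  qed
  ultimately show ?thesis by (rule that)
qed

end

lemma linear_map_on_zero:
  assumes "linear_map_on V fscale t T" "0 \<in> V" "vector_space t"
  shows "T 0 = 0"
proof -
  interpret t: vector_space t by (rule assms(3))
  have "T (fscale 0 0) = t 0 (T 0)" using assms by (auto simp only: linear_map_on_def)
  then show ?thesis by simp
qed

lemma linear_map_on_sum:
  fixes V :: "('v \<Rightarrow> 'k::field) set"
  assumes T: "linear_map_on V fscale t T" and V: "fs.subspace V" and t: "vector_space t"
    and f: "\<And>i. i \<in> I \<Longrightarrow> f i \<in> V"
  shows "T (\<Sum>i\<in>I. f i) = (\<Sum>i\<in>I. T (f i))"
  using f
proof (induction I rule: infinite_finite_induct)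
  case (insert i I)
  then have "sum f I \<in> V" by (intro fs.subspace_sum[OF V]) auto
  then have "T (f i + sum f I) = T (f i) + T (sum f I)" using T insert by (simp add: linear_map_on_def)
  then show ?case using insert by (simp del: plus_fun_apply)
qed (simp_all add: linear_map_on_zero[OF T fs.subspace_0[OF V] t])

lemma finite_net_cball:
  fixes r :: real
  assumes "\<eta> > 0"
  obtains Z :: "'k::euclidean_space set"
  where "finite Z" "\<And>z. norm z \<le> r \<Longrightarrow> \<exists>w\<in>Z. norm (z - w) \<le> \<eta>"
proof -
  have "compact (cball (0::'k) r)" by simp
  then obtain Z :: "'k set" where Z: "finite Z" "cball 0 r \<subseteq> (\<Union>w\<in>Z. ball w \<eta>)"
    using assms unfolding compact_eq_totally_bounded by meson
  show ?thesis
  proof (rule that[OF Z(1)])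
    fix z :: 'k assume "norm z \<le> r"
    then obtain w where "w \<in> Z" "dist w z < \<eta>" using Z(2) by (auto simp: subset_iff)
    then show "\<exists>w\<in>Z. norm (z - w) \<le> \<eta>" by (intro bexI[of _ w]) (auto simp: dist_norm norm_minus_commute)
  qed
qed

section \<open>Finite nets, and the passage from a net to the whole of
  \<open>M\<^sub>0\<close>\<close>

context banach_space_over
begin

text \<open>Coordinates are values at the nodes, so on the unit ball they are bounded by the dual
  norms of the nodes. Choosing each of them from a finite net of scalars gives a net in
  \<open>M\<^sub>0\<close>.\<close>

lemma finite_net_bidual:
  fixes M\<^sub>0 :: "(('e \<Rightarrow> 'k) \<Rightarrow> 'k) set"
  assumes M0: "fin_dim_subspace fscale M\<^sub>0" "M\<^sub>0 \<subseteq> bidual scale" and \<eta>: "\<eta> > 0"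
  obtains G where "finite G" "G \<subseteq> M\<^sub>0"
    "\<And>\<Phi>. \<Phi> \<in> M\<^sub>0 \<Longrightarrow> bidual_norm scale \<Phi> \<le> 1 \<Longrightarrow> \<exists>\<Psi>\<in>G. bidual_norm scale (\<Phi> - \<Psi>) \<le> \<eta>"
proof -
  let ?n = "bidual_norm scale"
  obtain S e where S: "finite S" "S \<subseteq> dual scale" "\<And>s. s \<in> S \<Longrightarrow> e s \<in> M\<^sub>0"
    "\<And>\<Phi>. \<Phi> \<in> M\<^sub>0 \<Longrightarrow> (\<Sum>s\<in>S. fscale (\<Phi> s) (e s)) = \<Phi>"
    using interpolation_basis_dual_of[OF M0[unfolded bidual_def]] by metis
  have sub: "fs.subspace M\<^sub>0" using M0(1) by (auto simp: fin_dim_subspace_def)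
  have e_nonneg: "0 \<le> ?n (e s)" if "s \<in> S" for s using S(3)[OF that] M0(2) B.n_nonneg by blast
  define r where "r = (\<Sum>s\<in>S. dual_norm s)"
  \<comment> \<open>The added 1 keeps the denominator positive even if all \<open>e s\<close> have
    norm 0.\<close>
  define \<eta>' where "\<eta>' = \<eta> / ((\<Sum>s\<in>S. ?n (e s)) + 1)"
  have pos: "(\<Sum>s\<in>S. ?n (e s)) \<ge> 0" using e_nonneg by (rule sum_nonneg)
  have \<eta>': "\<eta>' > 0" unfolding \<eta>'_def using \<eta> pos by simp
  obtain Z :: "'k set" where Z: "finite Z" "\<And>z. norm z \<le> r \<Longrightarrow> \<exists>w\<in>Z. norm (z - w) \<le> \<eta>'"
    by (rule finite_net_cball[OF \<eta>', where r = r]) (rule that)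
  define comb where "comb t = (\<Sum>s\<in>S. fscale (t s) (e s))" for t
  show ?thesis
  proof (rule that[of "comb ` PiE S (\<lambda>_. Z)"])
    show "finite (comb ` PiE S (\<lambda>_. Z))" using S(1) Z(1) by (intro finite_imageI finite_PiE)
    show "comb ` PiE S (\<lambda>_. Z) \<subseteq> M\<^sub>0"
      unfolding comb_def using S(3) by (auto intro!: fs.subspace_sum[OF sub] fs.subspace_scale[OF sub])
    fix \<Phi> assume \<Phi>: "\<Phi> \<in> M\<^sub>0" "?n \<Phi> \<le> 1"
    have "norm (\<Phi> s) \<le> r" if "s \<in> S" for s
    proof -
      have "norm (\<Phi> s) \<le> ?n \<Phi> * dual_norm s" using \<Phi>(1) M0(2) S(2) that by (intro norm_le_bidual_norm) auto
      also have "\<dots> \<le> 1 * dual_norm s" using \<Phi>(2) D.n_nonneg S(2) that by (intro mult_right_mono) auto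
      also have "dual_norm s \<le> r"
        unfolding r_def using S D.n_nonneg that by (intro member_le_sum) auto
      finally show ?thesis by simp
    qed
    then have "\<exists>w. \<forall>s\<in>S. w s \<in> Z \<and> norm (\<Phi> s - w s) \<le> \<eta>'" using Z(2) by (intro bchoice) blast
    then obtain w where w: "\<And>s. s \<in> S \<Longrightarrow> w s \<in> Z \<and> norm (\<Phi> s - w s) \<le> \<eta>'" by blast
    define t where "t = restrict w S"
    have t: "t \<in> PiE S (\<lambda>_. Z)" using w by (auto simp: t_def)
    have "comb t = (\<Sum>s\<in>S. fscale (w s) (e s))" by (simp add: comb_def t_def)
    then have "\<Phi> - comb t = (\<Sum>s\<in>S. fscale (\<Phi> s - w s) (e s))"
      using S(4)[OF \<Phi>(1)] by (simp add: fs.scale_left_diff_distrib sum_subtractf del: minus_apply)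
    then have "?n (\<Phi> - comb t) = ?n (\<Sum>s\<in>S. fscale (\<Phi> s - w s) (e s))" by (rule arg_cong)
    also have "\<dots> \<le> (\<Sum>s\<in>S. ?n (fscale (\<Phi> s - w s) (e s)))"
      by (intro bidual_norm_sum subsetD[OF M0(2)] fs.subspace_scale[OF sub] S(3))
    also have "\<dots> = (\<Sum>s\<in>S. norm (\<Phi> s - w s) * ?n (e s))"
      using B.n_scale S(3) M0(2) by (intro sum.cong) auto
    also have "\<dots> \<le> (\<Sum>s\<in>S. \<eta>' * ?n (e s))"
      using w e_nonneg by (intro sum_mono mult_right_mono) auto
    also have "\<dots> = \<eta>' * (\<Sum>s\<in>S. ?n (e s))" by (simp add: sum_distrib_left)
    also have "\<dots> \<le> \<eta>" using pos \<eta> by (simp add: \<eta>'_def field_simps)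
    finally show "\<exists>\<Psi>\<in>comb ` PiE S (\<lambda>_. Z). ?n (\<Phi> - \<Psi>) \<le> \<eta>" using t by blast
  qed
qed

lemma eps_isomorphism_on_if_unit:
  assumes sub: "fs.subspace M\<^sub>0" "M\<^sub>0 \<subseteq> bidual scale" and T: "linear_map_on M\<^sub>0 fscale scale T"
    and unit: "\<And>\<Phi>. \<Phi> \<in> M\<^sub>0 \<Longrightarrow> bidual_norm scale \<Phi> = 1 \<Longrightarrow> 1 - \<epsilon> \<le> norm (T \<Phi>) \<and> norm (T \<Phi>) \<le> 1 + \<epsilon>"
  shows "eps_isomorphism_on \<epsilon> M\<^sub>0 fscale (bidual_norm scale) scale T"
  unfolding eps_isomorphism_on_def
proof (intro conjI ballI T)
  fix \<Phi> assume \<Phi>: "\<Phi> \<in> M\<^sub>0"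
  let ?n = "bidual_norm scale"
  have "(1 - \<epsilon>) * ?n \<Phi> \<le> norm (T \<Phi>) \<and> norm (T \<Phi>) \<le> (1 + \<epsilon>) * ?n \<Phi>"
  proof (cases "?n \<Phi> = 0")
    case True
    then have "\<Phi> = 0" using bidual_norm_eq_0 \<Phi> sub(2) by blast
    moreover have "T 0 = 0"
      using linear_map_on_zero[OF T fs.subspace_0[OF sub(1)]] vector_space_axioms by blast
    ultimately show ?thesis using True by (simp del: zero_fun_apply)
  next
    case False
    then have pos: "?n \<Phi> > 0" using B.n_nonneg[of \<Phi>] \<Phi> sub(2) by (metis order_less_le subsetD)
    define z where "z = (of_real (inverse (?n \<Phi>)) :: 'k)"
    have z: "norm z = inverse (?n \<Phi>)" using pos by (simp add: z_def norm_inverse)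
    have "?n (fscale z \<Phi>) = 1" using B.n_scale[of \<Phi> z] \<Phi> sub(2) z pos by auto
    moreover have "T (fscale z \<Phi>) = scale z (T \<Phi>)" using T \<Phi> by (simp add: linear_map_on_def)
    ultimately have "1 - \<epsilon> \<le> norm z * norm (T \<Phi>) \<and> norm z * norm (T \<Phi>) \<le> 1 + \<epsilon>"
      using unit[of "fscale z \<Phi>"] fs.subspace_scale[OF sub(1) \<Phi>] by (simp add: norm_scale)
    then show ?thesis using pos by (simp add: z field_simps)
  qed
  then show "(1 - \<epsilon>) * ?n \<Phi> \<le> norm (T \<Phi>)" "norm (T \<Phi>) \<le> (1 + \<epsilon>) * ?n \<Phi>" by auto
qed

text \<open>Including the elements \<open>e s\<close> among the controlled points bounds
  \<open>T\<close> by \<open>k\<close> independently of the net, so the net can be chosen after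
  \<open>k\<close>. Lower estimates need no further inequality: \<open>N'\<close> contains an almost
  norming functional for each net point, and \<open>T\<close> respects its value exactly.\<close>

lemma local_reflexivity:
  fixes M\<^sub>0 :: "(('e \<Rightarrow> 'k) \<Rightarrow> 'k) set"
  assumes M0: "fin_dim_subspace fscale M\<^sub>0" "M\<^sub>0 \<subseteq> bidual scale"
    and N: "fin_dim_subspace fscale N" "N \<subseteq> dual scale"
    and D: "finite D" "\<And>R \<Phi>. (R, \<Phi>) \<in> D \<Longrightarrow> bounded_op scale R \<and> \<Phi> \<in> M\<^sub>0 \<and> bidual_op scale R \<Phi> \<in> M\<^sub>0"
    and \<epsilon>: "\<epsilon> > 0" and \<gamma>: "\<gamma> > 0"
  obtains T where "eps_isomorphism_on \<epsilon> M\<^sub>0 fscale (bidual_norm scale) scale T"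
    "\<And>\<Phi> \<mu>. \<Phi> \<in> M\<^sub>0 \<Longrightarrow> \<mu> \<in> N \<Longrightarrow> \<Phi> \<mu> = \<mu> (T \<Phi>)"
    "\<And>x. canonical_embedding scale x \<in> M\<^sub>0 \<Longrightarrow> T (canonical_embedding scale x) = x"
    "\<And>R \<Phi>. (R, \<Phi>) \<in> D \<Longrightarrow> norm (R (T \<Phi>) - T (bidual_op scale R \<Phi>)) \<le> \<gamma>"
proof -
  let ?n = "bidual_norm scale"
  obtain S e where S: "finite S" "S \<subseteq> dual scale" "\<And>s. s \<in> S \<Longrightarrow> e s \<in> M\<^sub>0"
    "\<And>\<Phi>. \<Phi> \<in> M\<^sub>0 \<Longrightarrow> (\<Sum>s\<in>S. fscale (\<Phi> s) (e s)) = \<Phi>"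
    using interpolation_basis_dual_of[OF M0[unfolded bidual_def]] by metis
  have sub: "fs.subspace M\<^sub>0" using M0(1) by (auto simp: fin_dim_subspace_def)
  have bi: "\<Phi> \<in> bidual scale" if "\<Phi> \<in> M\<^sub>0" for \<Phi> using that M0(2) by blast
  \<comment> \<open>The factor 2 bounds \<open>1 + \<delta>\<close>, as
    \<open>\<delta> \<le> 1\<close>.\<close>
  define k where "k = 2 * (\<Sum>s\<in>S. dual_norm s * ?n (e s))"
  define \<delta> where "\<delta> = min 1 (\<epsilon> / 2)"
  \<comment> \<open>Chosen so that \<open>k * \<eta> + 2 * \<eta> = \<epsilon> / 2\<close>:
    \<open>k * \<eta>\<close> pays for replacing a unit vector by a net point,
    \<open>2 * \<eta>\<close> for the errors at the net point. The other half of
    \<open>\<epsilon>\<close> is for \<open>\<delta>\<close>.\<close>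
  define \<eta> where "\<eta> = \<epsilon> / 2 / (k + 2)"
  have "(\<Sum>s\<in>S. dual_norm s * ?n (e s)) \<ge> 0"
    using S D.n_nonneg B.n_nonneg bi by (intro sum_nonneg mult_nonneg_nonneg) auto
  then have k: "k \<ge> 0" by (simp add: k_def)
  have \<eta>: "\<eta> > 0" using k \<epsilon> by (simp add: \<eta>_def)
  have "k + 2 \<noteq> 0" using k by simp
  then have "\<eta> * (k + 2) = \<epsilon> / 2"
    unfolding \<eta>_def by (metis nonzero_eq_divide_eq)
  then have k\<eta>: "k * \<eta> + 2 * \<eta> = \<epsilon> / 2" by (simp add: algebra_simps)
  have \<delta>: "\<delta> > 0" "\<delta> \<le> 1" "\<delta> \<le> \<epsilon> / 2" using \<epsilon> by (auto simp: \<delta>_def)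
  obtain G where G: "finite G" "G \<subseteq> M\<^sub>0"
    "\<And>\<Phi>. \<Phi> \<in> M\<^sub>0 \<Longrightarrow> ?n \<Phi> \<le> 1 \<Longrightarrow> \<exists>\<Psi>\<in>G. ?n (\<Phi> - \<Psi>) \<le> \<eta>"
    by (rule finite_net_bidual[OF M0 \<eta>]) (rule that)
  have "\<exists>\<mu>. \<mu> \<in> dual scale \<and> dual_norm \<mu> \<le> 1 \<and> ?n \<Psi> - \<eta> < norm (\<Psi> \<mu>)" if "\<Psi> \<in> G" for \<Psi>
    by (rule bidual_norm_approx[OF bi[OF subsetD[OF G(2) that]] \<eta>]) blast
  then obtain m where m: "\<And>\<Psi>. \<Psi> \<in> G \<Longrightarrow> m \<Psi> \<in> dual scale \<and> dual_norm (m \<Psi>) \<le> 1 \<and> ?n \<Psi> - \<eta> < norm (\<Psi> (m \<Psi>))"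
    by metis
  obtain BN where BN: "finite BN" "N = fs.span BN" using N(1) by (auto simp: fin_dim_subspace_def)
  define N' where "N' = fs.span (BN \<union> m ` G)"
  have N': "fin_dim_subspace fscale N'"
    unfolding fin_dim_subspace_def N'_def using BN G(1) by (intro exI[of _ "BN \<union> m ` G"]) auto
  have N'_dual: "N' \<subseteq> dual scale"
    unfolding N'_def using BN(2) N(2) fs.span_superset[of BN] m
    by (intro fs.span_minimal subspace_dual) auto
  have N_N': "N \<subseteq> N'" unfolding N'_def BN(2) by (intro fs.span_mono) auto
  have m_N': "m \<Psi> \<in> N'" if "\<Psi> \<in> G" for \<Psi> unfolding N'_def using that by (intro fs.span_base) auto
  have "finite (G \<union> e ` S)" "G \<union> e ` S \<subseteq> M\<^sub>0" using G S by auto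
  then obtain T where T: "linear_map_on M\<^sub>0 fscale scale T"
    and T_N': "\<And>\<Phi> \<mu>. \<Phi> \<in> M\<^sub>0 \<Longrightarrow> \<mu> \<in> N' \<Longrightarrow> \<Phi> \<mu> = \<mu> (T \<Phi>)"
    and T_emb: "\<And>x. canonical_embedding scale x \<in> M\<^sub>0 \<Longrightarrow> T (canonical_embedding scale x) = x"
    and T_F: "\<And>\<Phi>. \<Phi> \<in> G \<union> e ` S \<Longrightarrow> norm (T \<Phi>) \<le> (1 + \<delta>) * ?n \<Phi>"
    and T_D: "\<And>R \<Phi>. (R, \<Phi>) \<in> D \<Longrightarrow> norm (R (T \<Phi>) - T (bidual_op scale R \<Phi>)) \<le> \<gamma>"
    by (rule local_reflexivity_finite[OF M0 N' N'_dual _ _ D \<delta>(1) \<gamma>]) (assumption | rule that)+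
  have T_bound: "norm (T \<Phi>) \<le> k * ?n \<Phi>" if \<Phi>: "\<Phi> \<in> M\<^sub>0" for \<Phi>
  proof -
    have "T \<Phi> = T (\<Sum>s\<in>S. fscale (\<Phi> s) (e s))" by (simp only: S(4)[OF \<Phi>])
    also have "\<dots> = (\<Sum>s\<in>S. T (fscale (\<Phi> s) (e s)))"
      by (intro linear_map_on_sum[OF T sub vector_space_axioms] fs.subspace_scale[OF sub] S(3))
    also have "\<dots> = (\<Sum>s\<in>S. scale (\<Phi> s) (T (e s)))"
      using T S(3) by (intro sum.cong) (auto simp: linear_map_on_def)
    also have "norm \<dots> \<le> (\<Sum>s\<in>S. (?n \<Phi> * dual_norm s) * (2 * ?n (e s)))"
    proof (rule sum_norm_le)
      fix s assume s: "s \<in> S"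
      have es: "0 \<le> ?n (e s)" using B.n_nonneg bi S(3)[OF s] by blast
      have "norm (T (e s)) \<le> (1 + \<delta>) * ?n (e s)" using T_F s by blast
      also have "\<dots> \<le> 2 * ?n (e s)" using \<delta>(2) es by (intro mult_right_mono) auto
      finally have 1: "norm (T (e s)) \<le> 2 * ?n (e s)" .
      have 2: "norm (\<Phi> s) \<le> ?n \<Phi> * dual_norm s" using S(2) s by (intro norm_le_bidual_norm bi \<Phi>) auto
      show "norm (scale (\<Phi> s) (T (e s))) \<le> (?n \<Phi> * dual_norm s) * (2 * ?n (e s))"
        unfolding norm_scale using 1 2 es order_trans[OF norm_ge_zero 2] by (intro mult_mono) auto
    qed
    also have "\<dots> = k * ?n \<Phi>"
      by (simp add: k_def sum_distrib_left sum_distrib_right ac_simps)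
    finally show ?thesis .
  qed
  have "1 - \<epsilon> \<le> norm (T \<Phi>) \<and> norm (T \<Phi>) \<le> 1 + \<epsilon>" if \<Phi>: "\<Phi> \<in> M\<^sub>0" "?n \<Phi> = 1" for \<Phi>
  proof -
    obtain \<Psi> where \<Psi>: "\<Psi> \<in> G" "?n (\<Phi> - \<Psi>) \<le> \<eta>" using G(3)[OF \<Phi>(1)] \<Phi>(2) by auto
    have \<Psi>M: "\<Psi> \<in> M\<^sub>0" using \<Psi> G(2) by blast
    have dM: "\<Phi> - \<Psi> \<in> M\<^sub>0" using \<Phi>(1) \<Psi>M by (rule fs.subspace_diff[OF sub])
    have "T (\<Phi> - \<Psi> + \<Psi>) = T (\<Phi> - \<Psi>) + T \<Psi>" using T dM \<Psi>M unfolding linear_map_on_def by blast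
    then have T\<Phi>: "T \<Phi> = T (\<Phi> - \<Psi>) + T \<Psi>" by (simp del: plus_fun_apply minus_apply)
    have "norm (T (\<Phi> - \<Psi>)) \<le> k * ?n (\<Phi> - \<Psi>)" by (rule T_bound[OF dM])
    also have "\<dots> \<le> k * \<eta>" using \<Psi>(2) k by (rule mult_left_mono)
    finally have Td: "norm (T (\<Phi> - \<Psi>)) \<le> k * \<eta>" .
    have neg: "?n (- (\<Phi> - \<Psi>)) = ?n (\<Phi> - \<Psi>)"
      using B.n_scale[OF bi[OF dM], of "-1"] by (simp del: minus_apply)
    have "?n (\<Phi> + (- (\<Phi> - \<Psi>))) \<le> ?n \<Phi> + ?n (- (\<Phi> - \<Psi>))"
      using \<Phi>(1) dM by (intro bidual_norm_add bi fs.subspace_neg[OF sub])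
    then have up: "?n \<Psi> \<le> 1 + \<eta>" using neg \<Psi>(2) \<Phi>(2) by (simp del: plus_fun_apply minus_apply)
    have "?n (\<Psi> + (\<Phi> - \<Psi>)) \<le> ?n \<Psi> + ?n (\<Phi> - \<Psi>)"
      using \<Psi>M dM by (intro bidual_norm_add bi)
    then have low: "1 - \<eta> \<le> ?n \<Psi>" using \<Psi>(2) \<Phi>(2) by (simp del: plus_fun_apply minus_apply)
    have "norm (T \<Psi>) \<le> (1 + \<delta>) * (1 + \<eta>)"
      using T_F[of \<Psi>] \<Psi>(1) up \<delta> by (smt (verit) UnI1 mult_left_mono)
    also have "\<dots> = 1 + \<delta> + \<eta> + \<delta> * \<eta>" by (simp add: algebra_simps)
    also have "\<delta> * \<eta> \<le> 1 * \<eta>" using \<delta> \<eta> by (intro mult_right_mono) auto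
    finally have T\<Psi>_up: "norm (T \<Psi>) \<le> 1 + \<delta> + 2 * \<eta>" by simp
    have "?n \<Psi> - \<eta> \<le> norm (m \<Psi> (T \<Psi>))"
      using m[OF \<Psi>(1)] T_N'[OF \<Psi>M m_N'[OF \<Psi>(1)]] by simp
    also have "\<dots> \<le> dual_norm (m \<Psi>) * norm (T \<Psi>)" using m[OF \<Psi>(1)] by (intro norm_le_dual_norm) simp
    also have "\<dots> \<le> 1 * norm (T \<Psi>)" using m[OF \<Psi>(1)] by (intro mult_right_mono) auto
    finally have T\<Psi>_low: "1 - 2 * \<eta> \<le> norm (T \<Psi>)" using low by simp
    have "norm (T \<Phi>) \<le> norm (T (\<Phi> - \<Psi>)) + norm (T \<Psi>)" unfolding T\<Phi> by (rule norm_triangle_ineq)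
    moreover have "norm (T \<Psi>) - norm (T (\<Phi> - \<Psi>)) \<le> norm (T \<Phi>)"
      unfolding T\<Phi> by (metis add.commute norm_diff_ineq)
    ultimately show ?thesis using Td T\<Psi>_up T\<Psi>_low k\<eta> \<delta>(3) \<epsilon> by linarith
  qed
  then have "eps_isomorphism_on \<epsilon> M\<^sub>0 fscale ?n scale T"
    by (rule eps_isomorphism_on_if_unit[OF sub M0(2) T])
  then show ?thesis
    by (rule that) (erule T_N', erule subsetD[OF N_N'], erule T_emb, erule T_D)
qed

text \<open>Embedding \<open>L\<close> into its bidual makes it a space of functions, to which
  interpolation applies. The nodes are then bounded functionals on the whole space, and they serve
  as coordinates whose size is controlled by dual norms.\<close>

lemma finite_dim_coordinates:
  assumes "fin_dim_subspace scale L"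
  obtains J g where "finite J" "J \<subseteq> dual scale" "\<And>j. j \<in> J \<Longrightarrow> g j \<in> L"
    "\<And>a. a \<in> L \<Longrightarrow> (\<Sum>j\<in>J. scale (j a) (g j)) = a"
proof -
  interpret emb: module_hom scale fscale "canonical_embedding scale"
    by unfold_locales (auto simp: canonical_embedding_add canonical_embedding_scale simp del: plus_fun_apply)
  obtain B where B: "finite B" "L = span B" using assms by (auto simp: fin_dim_subspace_def)
  have "canonical_embedding scale ` L = fs.span (canonical_embedding scale ` B)"
    unfolding B(2) by (rule emb.span_image[symmetric])
  then have fd: "fin_dim_subspace fscale (canonical_embedding scale ` L)"
    using B(1) by (auto simp: fin_dim_subspace_def)
  have "canonical_embedding scale ` L \<subseteq> dual_of (dual scale) fscale dual_norm"
    using canonical_embedding_in_bidual unfolding bidual_def by blast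
  then obtain J e where J: "finite J" "J \<subseteq> dual scale" "\<And>j. j \<in> J \<Longrightarrow> e j \<in> canonical_embedding scale ` L"
    "\<And>\<Phi>. \<Phi> \<in> canonical_embedding scale ` L \<Longrightarrow> (\<Sum>j\<in>J. fscale (\<Phi> j) (e j)) = \<Phi>"
    by (rule interpolation_basis_dual_of[OF fd]) (rule that)
  define g where "g j = inv_into L (canonical_embedding scale) (e j)" for j
  have g: "g j \<in> L" "canonical_embedding scale (g j) = e j" if "j \<in> J" for j
    unfolding g_def using J(3)[OF that] by (rule inv_into_into, rule f_inv_into_f)
  have coord: "(\<Sum>j\<in>J. scale (j a) (g j)) = a" if "a \<in> L" for a
  proof (rule canonical_embedding_inject)
    have "canonical_embedding scale (\<Sum>j\<in>J. scale (j a) (g j)) = (\<Sum>j\<in>J. fscale (j a) (e j))"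
      by (simp add: canonical_embedding_sum canonical_embedding_scale g(2) cong: sum.cong_simp)
    also have "\<dots> = (\<Sum>j\<in>J. fscale (canonical_embedding scale a j) (e j))"
      using J(2) canonical_embedding_apply by (intro sum.cong) auto
    also have "\<dots> = canonical_embedding scale a" using that by (intro J(4)) blast
    finally show "canonical_embedding scale (\<Sum>j\<in>J. scale (j a) (g j)) = canonical_embedding scale a" .
  qed
  show ?thesis by (rule that[OF J(1,2) g(1) coord])
qed

end

section \<open>Module actions\<close>

text \<open>The common form of a left action and of a right action with its arguments
  exchanged.\<close>

locale bounded_action =
  A: banach_space_over scaleA + E: banach_space_over scaleE
  for scaleA :: "'k::{real_normed_field,euclidean_space} \<Rightarrow> 'a::banach \<Rightarrow> 'a"
    and scaleE :: "'k \<Rightarrow> 'e::banach \<Rightarrow> 'e" +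
  fixes act :: "'a \<Rightarrow> 'e \<Rightarrow> 'e"
  assumes add_left: "act (a + b) x = act a x + act b x"
    and add_right: "act a (x + y) = act a x + act a y"
    and scale_left: "act (scaleA z a) x = scaleE z (act a x)"
    and scale_right: "act a (scaleE z x) = scaleE z (act a x)"
    and bounded: "\<exists>C. \<forall>a x. norm (act a x) \<le> C * norm a * norm x"
begin

lemma bounded_op_act: "bounded_op scaleE (act a)"
  using bounded by (auto simp: bounded_op_def linear_map_on_def add_right scale_right)

lemma act_sum_left: "act (\<Sum>i\<in>I. f i) x = (\<Sum>i\<in>I. act (f i) x)"
proof (induction I rule: infinite_finite_induct)
  case (insert i I)
  then show ?case by (simp add: add_left)
qed (use scale_left[of 0 0] in auto)

text \<open>The defect is bilinear in \<open>a\<close> and \<open>\<Phi>\<close>, so finitely many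
  pairs of spanning elements control it. The conclusion quantifies over \<open>T\<close> because
  \<open>D\<close> and \<open>\<gamma>\<close> have to be known before \<open>T\<close> is
  constructed.\<close>

lemma defect_bound_on_span:
  fixes M M\<^sub>0 :: "(('e \<Rightarrow> 'k) \<Rightarrow> 'k) set"
  assumes L: "fin_dim_subspace scaleA L"
    and M: "fin_dim_subspace fscale M" "M \<subseteq> bidual scaleE"
    and M0: "fs.subspace M\<^sub>0" "M \<subseteq> M\<^sub>0"
    and act_M0: "\<And>a \<Phi>. a \<in> L \<Longrightarrow> \<Phi> \<in> M \<Longrightarrow> bidual_op scaleE (act a) \<Phi> \<in> M\<^sub>0"
    and \<epsilon>: "\<epsilon> > 0"
  obtains D \<gamma> where "finite D" "\<gamma> > 0"
    "\<And>R \<Phi>. (R, \<Phi>) \<in> D \<Longrightarrow> bounded_op scaleE R \<and> \<Phi> \<in> M\<^sub>0 \<and> bidual_op scaleE R \<Phi> \<in> M\<^sub>0"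
    "\<forall>T. linear_map_on M\<^sub>0 fscale scaleE T \<longrightarrow>
      (\<forall>R \<Phi>. (R, \<Phi>) \<in> D \<longrightarrow> norm (R (T \<Phi>) - T (bidual_op scaleE R \<Phi>)) \<le> \<gamma>) \<longrightarrow>
      (\<forall>a\<in>L. \<forall>\<Phi>\<in>M. norm (act a (T \<Phi>) - T (bidual_op scaleE (act a) \<Phi>))
        \<le> \<epsilon> * norm a * bidual_norm scaleE \<Phi>)"
proof -
  let ?n = "bidual_norm scaleE"
  obtain J g where J: "finite J" "J \<subseteq> dual scaleA" "\<And>j. j \<in> J \<Longrightarrow> g j \<in> L"
    "\<And>a. a \<in> L \<Longrightarrow> (\<Sum>j\<in>J. scaleA (j a) (g j)) = a"
    by (rule A.finite_dim_coordinates[OF L]) (rule that)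
  obtain S e where S: "finite S" "S \<subseteq> dual scaleE" "\<And>s. s \<in> S \<Longrightarrow> e s \<in> M"
    "\<And>\<Phi>. \<Phi> \<in> M \<Longrightarrow> (\<Sum>s\<in>S. fscale (\<Phi> s) (e s)) = \<Phi>"
    using interpolation_basis_dual_of[OF M[unfolded bidual_def]] by metis
  define D where "D = (\<lambda>(j, s). (act (g j), e s)) ` (J \<times> S)"
  \<comment> \<open>The total weight with which the defects at the spanning pairs enter, for
    \<open>a\<close> and \<open>\<Phi>\<close> of norm 1. The added 1 in \<open>\<gamma>\<close>
    avoids division by 0.\<close>
  define W where "W = (\<Sum>j\<in>J. \<Sum>s\<in>S. dual_norm j * dual_norm s)"
  define \<gamma> where "\<gamma> = \<epsilon> / (W + 1)"
  have W: "W \<ge> 0"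
    unfolding W_def using J(2) S(2) A.D.n_nonneg E.D.n_nonneg
    by (intro sum_nonneg mult_nonneg_nonneg) auto
  have \<gamma>: "\<gamma> > 0" using \<epsilon> W by (simp add: \<gamma>_def)
  have W\<gamma>: "W * \<gamma> \<le> \<epsilon>" using \<epsilon> W by (simp add: \<gamma>_def field_simps)
  \<comment> \<open>The second adjoint inherits linearity in \<open>a\<close> from the action, so it
    expands in the same coordinates as \<open>act a (T \<Phi>)\<close> does below.\<close>
  have bidual_act: "bidual_op scaleE (act a) \<Phi>
      = (\<Sum>j\<in>J. \<Sum>s\<in>S. fscale (j a * \<Phi> s) (bidual_op scaleE (act (g j)) (e s)))"
    if a: "a \<in> L" and \<Phi>: "\<Phi> \<in> M" for a \<Phi>
  proof
    fix \<mu>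
    show "bidual_op scaleE (act a) \<Phi> \<mu>
      = (\<Sum>j\<in>J. \<Sum>s\<in>S. fscale (j a * \<Phi> s) (bidual_op scaleE (act (g j)) (e s))) \<mu>"
    proof (cases "\<mu> \<in> dual scaleE")
      case True
      have b: "\<Phi> \<in> bidual scaleE" using \<Phi> M(2) by blast
      have c: "\<mu> \<circ> act b \<in> dual scaleE" for b using True bounded_op_act by (rule E.comp_bounded_op)
      have "\<mu> \<circ> act a = (\<Sum>j\<in>J. fscale (j a) (\<mu> \<circ> act (g j)))"
      proof
        fix x
        have "act a x = (\<Sum>j\<in>J. scaleE (j a) (act (g j) x))"
          using J(4)[OF a] act_sum_left[of "\<lambda>j. scaleA (j a) (g j)" J x] by (simp add: scale_left)
        then show "(\<mu> \<circ> act a) x = (\<Sum>j\<in>J. fscale (j a) (\<mu> \<circ> act (g j))) x"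
          by (simp add: E.dual_sum[OF True] E.dual_scale[OF True] sum_fun_apply fscale_apply)
      qed
      then have "\<Phi> (\<mu> \<circ> act a) = \<Phi> (\<Sum>j\<in>J. fscale (j a) (\<mu> \<circ> act (g j)))" by (rule arg_cong)
      also have "\<dots> = (\<Sum>j\<in>J. \<Phi> (fscale (j a) (\<mu> \<circ> act (g j))))"
        by (intro E.bidual_sum[OF b] fs.subspace_scale[OF E.subspace_dual] c)
      also have "\<dots> = (\<Sum>j\<in>J. j a * \<Phi> (\<mu> \<circ> act (g j)))"
        by (intro sum.cong refl E.bidual_fscale b c)
      also have "\<dots> = (\<Sum>j\<in>J. j a * (\<Sum>s\<in>S. fscale (\<Phi> s) (e s)) (\<mu> \<circ> act (g j)))"
        by (simp only: S(4)[OF \<Phi>])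
      finally show ?thesis
        using True by (simp add: bidual_op_def restr_def sum_fun_apply fscale_apply sum_distrib_left mult.assoc)
    next
      case False
      then show ?thesis by (simp add: bidual_op_def restr_def sum_fun_apply fscale_apply)
    qed
  qed
  show ?thesis
  proof (rule that[of D \<gamma>])
    show "finite D" using J(1) S(1) by (simp add: D_def)
    show "\<gamma> > 0" by (rule \<gamma>)
    show "bounded_op scaleE R \<and> \<Phi> \<in> M\<^sub>0 \<and> bidual_op scaleE R \<Phi> \<in> M\<^sub>0" if "(R, \<Phi>) \<in> D" for R \<Phi>
      using that bounded_op_act act_M0 J(3) S(3) M0(2) by (auto simp: D_def)
    have "norm (act a (T \<Phi>) - T (bidual_op scaleE (act a) \<Phi>)) \<le> \<epsilon> * norm a * ?n \<Phi>"
      if T: "linear_map_on M\<^sub>0 fscale scaleE T"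
        and T_D: "\<forall>R \<Phi>. (R, \<Phi>) \<in> D \<longrightarrow> norm (R (T \<Phi>) - T (bidual_op scaleE R \<Phi>)) \<le> \<gamma>"
        and a: "a \<in> L" and \<Phi>: "\<Phi> \<in> M" for T a \<Phi>
    proof -
      define \<Delta> where "\<Delta> j s = act (g j) (T (e s)) - T (bidual_op scaleE (act (g j)) (e s))" for j s
      note T_sum = linear_map_on_sum[OF T M0(1) E.vector_space_axioms]
      have T_scale: "T (fscale z \<Psi>) = scaleE z (T \<Psi>)" if "\<Psi> \<in> M\<^sub>0" for z \<Psi>
        using T that by (simp add: linear_map_on_def)
      have eM0: "e s \<in> M\<^sub>0" if "s \<in> S" for s using S(3)[OF that] M0(2) by blast
      have "T \<Phi> = T (\<Sum>s\<in>S. fscale (\<Phi> s) (e s))" by (simp only: S(4)[OF \<Phi>])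
      also have "\<dots> = (\<Sum>s\<in>S. T (fscale (\<Phi> s) (e s)))"
        using eM0 by (intro T_sum fs.subspace_scale[OF M0(1)])
      also have "\<dots> = (\<Sum>s\<in>S. scaleE (\<Phi> s) (T (e s)))" by (intro sum.cong refl T_scale eM0)
      finally have T\<Phi>: "T \<Phi> = (\<Sum>s\<in>S. scaleE (\<Phi> s) (T (e s)))" .
      have "act a (T \<Phi>) = (\<Sum>j\<in>J. scaleE (j a) (act (g j) (T \<Phi>)))"
        using J(4)[OF a] act_sum_left[of "\<lambda>j. scaleA (j a) (g j)" J "T \<Phi>"] by (simp add: scale_left)
      also have "\<dots> = (\<Sum>j\<in>J. \<Sum>s\<in>S. scaleE (j a * \<Phi> s) (act (g j) (T (e s))))"
        by (simp add: T\<Phi> E.bounded_op_sum[OF bounded_op_act] scale_right E.scale_sum_right)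
      finally have act_T: "act a (T \<Phi>) = (\<Sum>j\<in>J. \<Sum>s\<in>S. scaleE (j a * \<Phi> s) (act (g j) (T (e s))))" .
      have biM0: "bidual_op scaleE (act (g j)) (e s) \<in> M\<^sub>0" if "j \<in> J" "s \<in> S" for j s
        using that by (intro act_M0 J(3) S(3))
      have "T (bidual_op scaleE (act a) \<Phi>)
          = (\<Sum>j\<in>J. T (\<Sum>s\<in>S. fscale (j a * \<Phi> s) (bidual_op scaleE (act (g j)) (e s))))"
        unfolding bidual_act[OF a \<Phi>]
        by (intro T_sum fs.subspace_sum[OF M0(1)] fs.subspace_scale[OF M0(1)] biM0)
      also have "\<dots> = (\<Sum>j\<in>J. \<Sum>s\<in>S. T (fscale (j a * \<Phi> s) (bidual_op scaleE (act (g j)) (e s))))"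
        by (intro sum.cong refl T_sum fs.subspace_scale[OF M0(1)] biM0)
      also have "\<dots> = (\<Sum>j\<in>J. \<Sum>s\<in>S. scaleE (j a * \<Phi> s) (T (bidual_op scaleE (act (g j)) (e s))))"
        by (intro sum.cong refl T_scale biM0)
      finally have "act a (T \<Phi>) - T (bidual_op scaleE (act a) \<Phi>) = (\<Sum>j\<in>J. \<Sum>s\<in>S. scaleE (j a * \<Phi> s) (\<Delta> j s))"
        by (simp add: act_T \<Delta>_def E.scale_right_diff_distrib sum_subtractf)
      also have "norm \<dots> \<le> (\<Sum>j\<in>J. \<Sum>s\<in>S. ((dual_norm j * norm a) * (?n \<Phi> * dual_norm s)) * \<gamma>)"
      proof (intro sum_norm_le)
        fix j s assume j: "j \<in> J" and s: "s \<in> S"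
        have 1: "norm (j a) \<le> dual_norm j * norm a" using J(2) j by (intro A.norm_le_dual_norm) auto
        have 2: "norm (\<Phi> s) \<le> ?n \<Phi> * dual_norm s"
          using S(2) s \<Phi> M(2) by (intro E.norm_le_bidual_norm) auto
        have 3: "norm (\<Delta> j s) \<le> \<gamma>" unfolding \<Delta>_def using j s by (intro T_D[rule_format]) (auto simp: D_def)
        have "norm (j a * \<Phi> s) \<le> (dual_norm j * norm a) * (?n \<Phi> * dual_norm s)"
          unfolding norm_mult using 1 2 order_trans[OF norm_ge_zero 1] by (intro mult_mono) auto
        then show "norm (scaleE (j a * \<Phi> s) (\<Delta> j s)) \<le> ((dual_norm j * norm a) * (?n \<Phi> * dual_norm s)) * \<gamma>"
          unfolding E.norm_scale using 3 by (intro mult_mono) (auto intro: order_trans[OF norm_ge_zero])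
      qed
      also have "\<dots> = (W * \<gamma>) * (norm a * ?n \<Phi>)"
        by (simp add: W_def sum_distrib_left sum_distrib_right ac_simps)
      also have "\<dots> \<le> \<epsilon> * (norm a * ?n \<Phi>)"
        using W\<gamma> \<Phi> M(2) E.B.n_nonneg by (intro mult_right_mono) auto
      finally show ?thesis by (simp add: mult.assoc)
    qed
    then show "\<forall>T. linear_map_on M\<^sub>0 fscale scaleE T \<longrightarrow>
        (\<forall>R \<Phi>. (R, \<Phi>) \<in> D \<longrightarrow> norm (R (T \<Phi>) - T (bidual_op scaleE R \<Phi>)) \<le> \<gamma>) \<longrightarrow>
        (\<forall>a\<in>L. \<forall>\<Phi>\<in>M. norm (act a (T \<Phi>) - T (bidual_op scaleE (act a) \<Phi>))
          \<le> \<epsilon> * norm a * ?n \<Phi>)"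
      by blast
  qed
qed

end

section \<open>Left and right modules as bounded actions\<close>

lemma bounded_action_left:
  assumes "banach_left_module scaleA scaleE lact"
  shows "bounded_action scaleA scaleE lact"
proof -
  interpret banach_left_module scaleA scaleE lact by (rule assms)
  show ?thesis
    by unfold_locales
      (rule lact_add_left lact_add_right lact_scale_left lact_scale_right lact_bounded)+
qed

lemma bounded_action_right:
  assumes "banach_right_module scaleA scaleE ract"
  shows "bounded_action scaleA scaleE (\<lambda>a x. ract x a)"
proof -
  interpret banach_right_module scaleA scaleE ract by (rule assms)
  obtain C where "\<forall>x a. norm (ract x a) \<le> C * norm x * norm a" using ract_bounded by blast
  then have "\<exists>C. \<forall>a x. norm (ract x a) \<le> C * norm a * norm x"
    by (intro exI[of _ C]) (simp add: ac_simps)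
  then show ?thesis
    by unfold_locales (auto simp: ract_add_left ract_add_right ract_scale_left ract_scale_right)
qed

lemma bidual_lact_eq: "bidual_lact s l a = bidual_op s (l a)"
  by (simp add: fun_eq_iff bidual_lact_def dual_lact_def dual_ract_def bidual_op_def restr_def comp_def)

lemma bidual_ract_eq: "bidual_ract s r \<Phi> a = bidual_op s (\<lambda>x. r x a) \<Phi>"
  by (simp add: fun_eq_iff bidual_ract_def dual_lact_def dual_ract_def bidual_op_def restr_def comp_def)

text \<open>A bimodule needs one \<open>T\<close> for both defects: the two sets of constraints are
  united and the smaller tolerance is imposed. The one-sided cases arise by taking the same action
  twice.\<close>

lemma local_reflexivity_two_actions:
  fixes M M\<^sub>0 :: "(('e::banach \<Rightarrow> 'k::{real_normed_field,euclidean_space}) \<Rightarrow> 'k) set"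
  assumes 1: "bounded_action scaleA scaleE act" and 2: "bounded_action scaleA scaleE act'"
    and L: "fin_dim_subspace scaleA L"
    and M: "fin_dim_subspace fscale M" "M \<subseteq> bidual scaleE"
    and N: "fin_dim_subspace fscale N" "N \<subseteq> dual scaleE"
    and M0: "fin_dim_subspace fscale M\<^sub>0" "M\<^sub>0 \<subseteq> bidual scaleE" "M \<subseteq> M\<^sub>0"
    and act_M0: "\<And>a \<Phi>. a \<in> L \<Longrightarrow> \<Phi> \<in> M \<Longrightarrow> bidual_op scaleE (act a) \<Phi> \<in> M\<^sub>0"
    and act'_M0: "\<And>a \<Phi>. a \<in> L \<Longrightarrow> \<Phi> \<in> M \<Longrightarrow> bidual_op scaleE (act' a) \<Phi> \<in> M\<^sub>0"
    and \<epsilon>: "\<epsilon> > 0"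
  shows "\<exists>T. eps_isomorphism_on \<epsilon> M\<^sub>0 fscale (bidual_norm scaleE) scaleE T \<and>
    (\<forall>\<Phi>\<in>M\<^sub>0. \<forall>\<mu>\<in>N. \<Phi> \<mu> = \<mu> (T \<Phi>)) \<and>
    (\<forall>x. canonical_embedding scaleE x \<in> M\<^sub>0 \<longrightarrow> T (canonical_embedding scaleE x) = x) \<and>
    (\<forall>a\<in>L. \<forall>\<Phi>\<in>M. norm (act a (T \<Phi>) - T (bidual_op scaleE (act a) \<Phi>))
        \<le> \<epsilon> * norm a * bidual_norm scaleE \<Phi>) \<and>
    (\<forall>a\<in>L. \<forall>\<Phi>\<in>M. norm (act' a (T \<Phi>) - T (bidual_op scaleE (act' a) \<Phi>))
        \<le> \<epsilon> * norm a * bidual_norm scaleE \<Phi>)"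
proof -
  interpret act: bounded_action scaleA scaleE act by (rule 1)
  interpret act': bounded_action scaleA scaleE act' by (rule 2)
  have sub: "fs.subspace M\<^sub>0" using M0(1) by (auto simp: fin_dim_subspace_def)
  obtain D \<gamma> where D: "finite D" "\<gamma> > 0"
    "\<And>R \<Phi>. (R, \<Phi>) \<in> D \<Longrightarrow> bounded_op scaleE R \<and> \<Phi> \<in> M\<^sub>0 \<and> bidual_op scaleE R \<Phi> \<in> M\<^sub>0"
    and defect: "\<forall>T. linear_map_on M\<^sub>0 fscale scaleE T \<longrightarrow>
      (\<forall>R \<Phi>. (R, \<Phi>) \<in> D \<longrightarrow> norm (R (T \<Phi>) - T (bidual_op scaleE R \<Phi>)) \<le> \<gamma>) \<longrightarrow>
      (\<forall>a\<in>L. \<forall>\<Phi>\<in>M. norm (act a (T \<Phi>) - T (bidual_op scaleE (act a) \<Phi>))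
        \<le> \<epsilon> * norm a * bidual_norm scaleE \<Phi>)"
    by (rule act.defect_bound_on_span[OF L M sub M0(3) act_M0 \<epsilon>]) (assumption, assumption, rule that)
  obtain D' \<gamma>' where D': "finite D'" "\<gamma>' > 0"
    "\<And>R \<Phi>. (R, \<Phi>) \<in> D' \<Longrightarrow> bounded_op scaleE R \<and> \<Phi> \<in> M\<^sub>0 \<and> bidual_op scaleE R \<Phi> \<in> M\<^sub>0"
    and defect': "\<forall>T. linear_map_on M\<^sub>0 fscale scaleE T \<longrightarrow>
      (\<forall>R \<Phi>. (R, \<Phi>) \<in> D' \<longrightarrow> norm (R (T \<Phi>) - T (bidual_op scaleE R \<Phi>)) \<le> \<gamma>') \<longrightarrow>
      (\<forall>a\<in>L. \<forall>\<Phi>\<in>M. norm (act' a (T \<Phi>) - T (bidual_op scaleE (act' a) \<Phi>))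
        \<le> \<epsilon> * norm a * bidual_norm scaleE \<Phi>)"
    by (rule act'.defect_bound_on_span[OF L M sub M0(3) act'_M0 \<epsilon>]) (assumption, assumption, rule that)
  have fin: "finite (D \<union> D')" and pos: "min \<gamma> \<gamma>' > 0" using D D' by auto
  have ok: "bounded_op scaleE R \<and> \<Phi> \<in> M\<^sub>0 \<and> bidual_op scaleE R \<Phi> \<in> M\<^sub>0" if "(R, \<Phi>) \<in> D \<union> D'" for R \<Phi>
    using that D(3) D'(3) by (meson UnE)
  obtain T where T: "eps_isomorphism_on \<epsilon> M\<^sub>0 fscale (bidual_norm scaleE) scaleE T"
    and T_N: "\<And>\<Phi> \<mu>. \<Phi> \<in> M\<^sub>0 \<Longrightarrow> \<mu> \<in> N \<Longrightarrow> \<Phi> \<mu> = \<mu> (T \<Phi>)"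
    and T_emb: "\<And>x. canonical_embedding scaleE x \<in> M\<^sub>0 \<Longrightarrow> T (canonical_embedding scaleE x) = x"
    and T_D: "\<And>R \<Phi>. (R, \<Phi>) \<in> D \<union> D' \<Longrightarrow> norm (R (T \<Phi>) - T (bidual_op scaleE R \<Phi>)) \<le> min \<gamma> \<gamma>'"
    by (rule act.E.local_reflexivity[OF M0(1,2) N fin ok \<epsilon> pos]) (assumption, rule that)
  have lin: "linear_map_on M\<^sub>0 fscale scaleE T" using T by (simp add: eps_isomorphism_on_def)
  have "\<forall>R \<Phi>. (R, \<Phi>) \<in> D \<longrightarrow> norm (R (T \<Phi>) - T (bidual_op scaleE R \<Phi>)) \<le> \<gamma>"
    using T_D[OF UnI1] by simp
  note act_bound = defect[rule_format, OF lin this[rule_format]]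
  have "\<forall>R \<Phi>. (R, \<Phi>) \<in> D' \<longrightarrow> norm (R (T \<Phi>) - T (bidual_op scaleE R \<Phi>)) \<le> \<gamma>'"
    using T_D[OF UnI2] by simp
  note act'_bound = defect'[rule_format, OF lin this[rule_format]]
  show ?thesis
    by (intro exI[of _ T] conjI ballI allI impI T T_N T_emb act_bound act'_bound)
qed

lemma fin_dim_subspace_zero:
  fixes V :: "('v \<Rightarrow> 'k::field) set"
  assumes "fin_dim_subspace fscale V"
  shows "0 \<in> V"
  using assms fs.span_zero by (auto simp: fin_dim_subspace_def)

lemma left_product_mem: "a \<in> L \<Longrightarrow> \<Phi> \<in> M \<Longrightarrow> l a \<Phi> \<in> left_product_span l L M"
  unfolding left_product_span_def by (rule fs.span_base) blast

lemma right_product_mem: "a \<in> L \<Longrightarrow> \<Phi> \<in> M \<Longrightarrow> r \<Phi> a \<in> right_product_span r M L"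
  unfolding right_product_span_def by (rule fs.span_base) blast

lemma left_product_span_zero: "0 \<in> left_product_span l L M"
  unfolding left_product_span_def by (rule fs.span_zero)

lemma right_product_span_zero: "0 \<in> right_product_span r M L"
  unfolding right_product_span_def by (rule fs.span_zero)

theorem theorem3p1:
  fixes scaleA :: "'k::{real_normed_field,euclidean_space}
      \<Rightarrow> 'a::{banach,real_normed_algebra} \<Rightarrow> 'a"
    and scaleE :: "'k \<Rightarrow> 'e::banach \<Rightarrow> 'e"
    and lact :: "'a \<Rightarrow> 'e \<Rightarrow> 'e" and ract :: "'e \<Rightarrow> 'a \<Rightarrow> 'e"
    and M M\<^sub>0 :: "(('e \<Rightarrow> 'k) \<Rightarrow> 'k) set" and L :: "'a set" and N :: "('e \<Rightarrow> 'k) set"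
    and \<epsilon> :: real
  assumes A: "banach_algebra_over scaleA"
    and E: "banach_space_over scaleE"
    and M: "fin_dim_subspace fscale M" "M \<subseteq> bidual scaleE"
    and L: "fin_dim_subspace scaleA L"
    and N: "fin_dim_subspace fscale N" "N \<subseteq> dual scaleE"
    and M\<^sub>0: "fin_dim_subspace fscale M\<^sub>0" "M\<^sub>0 \<subseteq> bidual scaleE"
    and \<epsilon>: "\<epsilon> > 0"
  shows
    "(banach_left_module scaleA scaleE lact \<longrightarrow>
      left_product_span (bidual_lact scaleE lact) L M + M \<subseteq> M\<^sub>0 \<longrightarrow>
      (\<exists>T. eps_isomorphism_on \<epsilon> M\<^sub>0 fscale (bidual_norm scaleE) scaleE T \<and>
        (\<forall>\<Phi>\<in>M\<^sub>0. \<forall>\<mu>\<in>N. \<Phi> \<mu> = \<mu> (T \<Phi>)) \<and>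
        (\<forall>x. canonical_embedding scaleE x \<in> M\<^sub>0 \<longrightarrow> T (canonical_embedding scaleE x) = x) \<and>
        (\<forall>a\<in>L. \<forall>\<Phi>\<in>M. norm (lact a (T \<Phi>) - T (bidual_lact scaleE lact a \<Phi>))
            \<le> \<epsilon> * norm a * bidual_norm scaleE \<Phi>))) \<and>
     (banach_right_module scaleA scaleE ract \<longrightarrow>
      right_product_span (bidual_ract scaleE ract) M L + M \<subseteq> M\<^sub>0 \<longrightarrow>
      (\<exists>T. eps_isomorphism_on \<epsilon> M\<^sub>0 fscale (bidual_norm scaleE) scaleE T \<and>
        (\<forall>\<Phi>\<in>M\<^sub>0. \<forall>\<mu>\<in>N. \<Phi> \<mu> = \<mu> (T \<Phi>)) \<and>
        (\<forall>x. canonical_embedding scaleE x \<in> M\<^sub>0 \<longrightarrow> T (canonical_embedding scaleE x) = x) \<and>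
        (\<forall>a\<in>L. \<forall>\<Phi>\<in>M. norm (ract (T \<Phi>) a - T (bidual_ract scaleE ract \<Phi> a))
            \<le> \<epsilon> * norm a * bidual_norm scaleE \<Phi>))) \<and>
     (banach_bimodule scaleA scaleE lact ract \<longrightarrow>
      left_product_span (bidual_lact scaleE lact) L M
        + right_product_span (bidual_ract scaleE ract) M L + M \<subseteq> M\<^sub>0 \<longrightarrow>
      (\<exists>T. eps_isomorphism_on \<epsilon> M\<^sub>0 fscale (bidual_norm scaleE) scaleE T \<and>
        (\<forall>\<Phi>\<in>M\<^sub>0. \<forall>\<mu>\<in>N. \<Phi> \<mu> = \<mu> (T \<Phi>)) \<and>
        (\<forall>x. canonical_embedding scaleE x \<in> M\<^sub>0 \<longrightarrow> T (canonical_embedding scaleE x) = x) \<and>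
        (\<forall>a\<in>L. \<forall>\<Phi>\<in>M. norm (lact a (T \<Phi>) - T (bidual_lact scaleE lact a \<Phi>))
            \<le> \<epsilon> * norm a * bidual_norm scaleE \<Phi>) \<and>
        (\<forall>a\<in>L. \<forall>\<Phi>\<in>M. norm (ract (T \<Phi>) a - T (bidual_ract scaleE ract \<Phi> a))
            \<le> \<epsilon> * norm a * bidual_norm scaleE \<Phi>)))"
proof (intro conjI impI)
  \<comment> \<open>The hypotheses concern sums of subspaces; putting 0 into the other summands
    extracts the inclusion of each one.\<close>
  have M_zero: "0 \<in> M" by (rule fin_dim_subspace_zero[OF M(1)])
  show "\<exists>T. eps_isomorphism_on \<epsilon> M\<^sub>0 fscale (bidual_norm scaleE) scaleE T \<and>
        (\<forall>\<Phi>\<in>M\<^sub>0. \<forall>\<mu>\<in>N. \<Phi> \<mu> = \<mu> (T \<Phi>)) \<and>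
        (\<forall>x. canonical_embedding scaleE x \<in> M\<^sub>0 \<longrightarrow> T (canonical_embedding scaleE x) = x) \<and>
        (\<forall>a\<in>L. \<forall>\<Phi>\<in>M. norm (lact a (T \<Phi>) - T (bidual_lact scaleE lact a \<Phi>))
            \<le> \<epsilon> * norm a * bidual_norm scaleE \<Phi>)"
    if left: "banach_left_module scaleA scaleE lact"
      and sub: "left_product_span (bidual_lact scaleE lact) L M + M \<subseteq> M\<^sub>0"
  proof -
    have "M \<subseteq> M\<^sub>0" using set_plus_intro[OF left_product_span_zero] sub by fastforce
    moreover have "bidual_op scaleE (lact a) \<Phi> \<in> M\<^sub>0" if "a \<in> L" "\<Phi> \<in> M" for a \<Phi>
      using set_plus_intro[OF left_product_mem[OF that, of "bidual_lact scaleE lact"] M_zero] sub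
      by (auto simp: bidual_lact_eq simp del: plus_fun_apply zero_fun_apply)
    ultimately show ?thesis
      using local_reflexivity_two_actions[OF bounded_action_left[OF left] bounded_action_left[OF left] L M N M\<^sub>0 _ _ _ \<epsilon>]
      by (simp only: bidual_lact_eq) blast
  qed
  show "\<exists>T. eps_isomorphism_on \<epsilon> M\<^sub>0 fscale (bidual_norm scaleE) scaleE T \<and>
        (\<forall>\<Phi>\<in>M\<^sub>0. \<forall>\<mu>\<in>N. \<Phi> \<mu> = \<mu> (T \<Phi>)) \<and>
        (\<forall>x. canonical_embedding scaleE x \<in> M\<^sub>0 \<longrightarrow> T (canonical_embedding scaleE x) = x) \<and>
        (\<forall>a\<in>L. \<forall>\<Phi>\<in>M. norm (ract (T \<Phi>) a - T (bidual_ract scaleE ract \<Phi> a))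
            \<le> \<epsilon> * norm a * bidual_norm scaleE \<Phi>)"
    if right: "banach_right_module scaleA scaleE ract"
      and sub: "right_product_span (bidual_ract scaleE ract) M L + M \<subseteq> M\<^sub>0"
  proof -
    have "M \<subseteq> M\<^sub>0" using set_plus_intro[OF right_product_span_zero] sub by fastforce
    moreover have "bidual_op scaleE (\<lambda>x. ract x a) \<Phi> \<in> M\<^sub>0" if "a \<in> L" "\<Phi> \<in> M" for a \<Phi>
      using set_plus_intro[OF right_product_mem[OF that, of "bidual_ract scaleE ract"] M_zero] sub
      by (auto simp: bidual_ract_eq simp del: plus_fun_apply zero_fun_apply)
    ultimately show ?thesis
      using local_reflexivity_two_actions[OF bounded_action_right[OF right] bounded_action_right[OF right] L M N M\<^sub>0 _ _ _ \<epsilon>]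
      by (simp only: bidual_ract_eq) blast
  qed
  show "\<exists>T. eps_isomorphism_on \<epsilon> M\<^sub>0 fscale (bidual_norm scaleE) scaleE T \<and>
        (\<forall>\<Phi>\<in>M\<^sub>0. \<forall>\<mu>\<in>N. \<Phi> \<mu> = \<mu> (T \<Phi>)) \<and>
        (\<forall>x. canonical_embedding scaleE x \<in> M\<^sub>0 \<longrightarrow> T (canonical_embedding scaleE x) = x) \<and>
        (\<forall>a\<in>L. \<forall>\<Phi>\<in>M. norm (lact a (T \<Phi>) - T (bidual_lact scaleE lact a \<Phi>))
            \<le> \<epsilon> * norm a * bidual_norm scaleE \<Phi>) \<and>
        (\<forall>a\<in>L. \<forall>\<Phi>\<in>M. norm (ract (T \<Phi>) a - T (bidual_ract scaleE ract \<Phi> a))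
            \<le> \<epsilon> * norm a * bidual_norm scaleE \<Phi>)"
    if bi: "banach_bimodule scaleA scaleE lact ract"
      and sub: "left_product_span (bidual_lact scaleE lact) L M
        + right_product_span (bidual_ract scaleE ract) M L + M \<subseteq> M\<^sub>0"
  proof -
    have left: "banach_left_module scaleA scaleE lact" and right: "banach_right_module scaleA scaleE ract"
      using bi by (simp_all add: banach_bimodule_def)
    have sum: "\<Psi> + \<Psi>' + \<Phi> \<in> M\<^sub>0" if "\<Psi> \<in> left_product_span (bidual_lact scaleE lact) L M"
      "\<Psi>' \<in> right_product_span (bidual_ract scaleE ract) M L" "\<Phi> \<in> M" for \<Psi> \<Psi>' \<Phi>
      using that sub by (blast intro: set_plus_intro)
    have "\<Phi> \<in> M\<^sub>0" if "\<Phi> \<in> M" for \<Phi>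
      using sum[OF left_product_span_zero right_product_span_zero that] by (simp only: add_0_left)
    then have "M \<subseteq> M\<^sub>0" by blast
    moreover have "bidual_op scaleE (lact a) \<Phi> \<in> M\<^sub>0" if "a \<in> L" "\<Phi> \<in> M" for a \<Phi>
      using sum[OF left_product_mem[OF that] right_product_span_zero M_zero]
      by (simp only: add_0_right bidual_lact_eq)
    moreover have "bidual_op scaleE (\<lambda>x. ract x a) \<Phi> \<in> M\<^sub>0" if "a \<in> L" "\<Phi> \<in> M" for a \<Phi>
      using sum[OF left_product_span_zero right_product_mem[OF that] M_zero]
      by (simp only: add_0_left add_0_right bidual_ract_eq)
    ultimately show ?thesis
      using local_reflexivity_two_actions[OF bounded_action_left[OF left] bounded_action_right[OF right] L M N M\<^sub>0 _ _ _ \<epsilon>]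
      by (simp only: bidual_lact_eq bidual_ract_eq)
  qed
qed

end
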